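(* Let $q\ge 1$ be an integer, $\theta\in(0,1)$, and let $(y_t)_{1\le t\le n}$, $n\ge1$, be a signal time series in $\mathbb R^q$, with block second moments $\widehat\Sigma_{a:b}$, spectral ceiling $M$, spectral floor $m$, within-regime fluctuation $\Delta_{\mathrm{within}}$, between-regime contrast $\Delta_{\mathrm{between}}$, QML objective $J_n$, and grids $\mathcal D_n$, $\mathcal D_n(\delta)$ as defined in the context. Let $\varepsilon\ge 0$ be the regularization parameter in $J_n$; if $\varepsilon=0$, assume additionally that $m>0$. Assume $M<\infty$. Then: (i) If $$\Delta_{\mathrm{between}}>\frac{M+\varepsilon}{m+\varepsilon}\,\Delta_{\mathrm{within}},$$ then there are $\bar\delta,c>0$ such that $$\liminf_{n\to\infty}\bigl(J_n(\nu)-J_n(\theta)\bigr)\ \ge\ c\,|\nu-\theta|\qquad\text{for all }\nu\in(\theta-\bar\delta,\theta+\bar\delta)\cap(0,1).$$ (ii) If $$\Delta_{\mathrm{between}}>\frac{1}{2\sqrt{\theta(1-\theta)}}\cdot\frac{M+\varepsilon}{m+\varepsilon}\,\Delta_{\mathrm{within}},$$ then there is $c>0$ such that $$\liminf_{n\to\infty}\bigl(J_n(\nu)-J_n(\theta)\bigr)\ \ge\ c\,|\nu-\theta|\qquad\text{for all }\nu\in(0,1).$$ In particular, if $\varepsilon>0$, every sequence of untrimmed estimators $\hat\theta_n\in\arg\min_{\nu\in\mathcal D_n}J_n(\nu)$ satisfies $\lim_{n\to\infty}\hat\theta_n=\theta$. If $\varepsilon=0$, then for every $\delta\in(0,\min\{\theta,1-\theta\})$,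 every sequence of trimmed estimators $\hat\theta_{n,\delta}\in\arg\min_{\nu\in\mathcal D_n(\delta)}J_n(\nu)$ satisfies $\lim_{n\to\infty}\hat\theta_{n,\delta}=\theta$.
   Context: Signal series. For each $n\ge 1$, $y_1,\dots,y_n\in\mathbb R^q$ are given deterministic vectors (they may depend on $n$, $y_t=y_t^{(n)}$; no stochastic model is imposed). The number $\theta\in(0,1)$ is the break fraction. Blocks. For $0\le a<b\le1$ let $I(a,b)=\{\lfloor an\rfloor+1,\dots,\lfloor bn\rfloor\}$ and, when it is nonempty, $\widehat\Sigma_{a:b}=\frac{1}{|I(a,b)|}\sum_{t\in I(a,b)}y_ty_t^{\top}\in\mathbb R^{q\times q}$ (it depends on $n$; for fixed $a<b$ the block is nonempty for all large $n$). $\|\cdot\|$ is the operator norm, $\|\cdot\|_F$ the Frobenius norm, $\lambda_{\min}$ the smallest eigenvalue. Families of blocks: $\mathcal I_\theta^{\rm br}=\{I(s,\theta):0\le s<\theta\}\cup\{I(\theta,s):\theta<s\le1\}$ and $\mathcal I_\theta^{\rm cut}=\mathcal I_\theta^{\rm br}\cup\{I(0,s):0<s<\theta\}\cup\{I(s,1):\theta<s<1\}$ (indexed by the fractions $(a,b)$). Spectral bounds: $M:=\sup_{I(a,b)\in\mathcal I_\theta^{\rm br}}\limsup_{n\to\infty}\|\widehat\Sigma_{a:b}\|$ and $m:=\inf_{I(a,b)\in\mathcal I_\theta^{\rm cut}}\liminf_{n\to\infty}\lambda_{\min}(\widehat\Sigma_{a:b})$. Noise and signal: $\Delta_{\mathrm{within}}:=\sup\limsup_{n\to\infty}\|\widehat\Sigma_{a_1:b_1}-\widehat\Sigma_{a_2:b_2}\|_F$,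 the supremum over all $(a_1,b_1),(a_2,b_2)$ with either $0\le a_i<b_i\le\theta$ for $i=1,2$, or $\theta\le a_i<b_i\le1$ for $i=1,2$. $\Delta_{\mathrm{between}}:=\inf\liminf_{n\to\infty}\|\widehat\Sigma_{a_1:b_1}-\widehat\Sigma_{a_2:b_2}\|_F$, the infimum over $0\le a_1<b_1\le\theta$ and $\theta\le a_2<b_2\le1$. All these are elements of $[0,\infty]$. QML objective. For fixed $\varepsilon\ge0$ and $\nu\in(0,1)$ with $1\le\lfloor\nu n\rfloor\le n-1$, $$J_n(\nu):=\nu\log\det(\widehat\Sigma_{0:\nu}+\varepsilon I_q)+(1-\nu)\log\det(\widehat\Sigma_{\nu:1}+\varepsilon I_q),$$ with $\log 0=-\infty$. Grids: $\mathcal D_n=\{k/n:1\le k\le n-1\}$ and $\mathcal D_n(\delta)=\mathcal D_n\cap[\delta,1-\delta]$ for $0<\delta<1/2$. *)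

theory Defs
  imports "HOL-Analysis.Analysis"
begin

text \<open>
  A signal is a triangular array: \<open>y n t\<close> is the vector at time \<open>t\<close> in the series of length
  \<open>n\<close>. Only the values with \<open>1 \<le> t \<le> n\<close> are ever used. The dimension of the
  vectors is \<open>CARD('q)\<close>. Blocks are indexed by pairs of fractions \<open>(a, b)\<close>.
\<close>

type_synonym 'q signal = "nat \<Rightarrow> nat \<Rightarrow> real ^ 'q"

definition block :: "nat \<Rightarrow> real \<Rightarrow> real \<Rightarrow> nat set" where
  "block n a b = {nat \<lfloor>a * real n\<rfloor> + 1 .. nat \<lfloor>b * real n\<rfloor>}"

definition outer :: "real ^ 'q \<Rightarrow> real ^ 'q ^ 'q" where
  "outer v = (\<chi> i j. v $ i * v $ j)"

text \<open>
  For an empty block this is the zero matrix. For fixed \<open>a < b\<close> the block is empty for finitely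
  many \<open>n\<close> only, so the limits below do not depend on this value.
\<close>

definition second_moment :: "'q::finite signal \<Rightarrow> nat \<Rightarrow> real \<Rightarrow> real \<Rightarrow> real ^ 'q ^ 'q" where
  "second_moment y n a b =
     (1 / real (card (block n a b))) *\<^sub>R (\<Sum>t\<in>block n a b. outer (y n t))"

definition op_norm :: "real ^ 'q ^ 'q \<Rightarrow> real" where
  "op_norm A = onorm ((*v) A)"

definition frob_norm :: "real ^ 'q ^ 'q \<Rightarrow> real" where
  "frob_norm A = sqrt (\<Sum>i\<in>UNIV. \<Sum>j\<in>UNIV. (A $ i $ j)\<^sup>2)"

text \<open>
  The set of eigenvalues is finite for every square matrix, and it is nonempty for the symmetric
  matrices to which \<open>lambda_min\<close> is applied.
\<close>

definition lambda_min :: "real ^ 'q ^ 'q \<Rightarrow> real" where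
  "lambda_min A = Min {l. \<exists>v. v \<noteq> 0 \<and> A *v v = l *\<^sub>R v}"

definition br_blocks :: "real \<Rightarrow> (real \<times> real) set" where
  "br_blocks \<theta> = {(s, \<theta>) | s. 0 \<le> s \<and> s < \<theta>} \<union> {(\<theta>, s) | s. \<theta> < s \<and> s \<le> 1}"

definition cut_blocks :: "real \<Rightarrow> (real \<times> real) set" where
  "cut_blocks \<theta> =
     br_blocks \<theta> \<union> {(0, s) | s. 0 < s \<and> s < \<theta>} \<union> {(s, 1) | s. \<theta> < s \<and> s < 1}"

definition pre_blocks :: "real \<Rightarrow> (real \<times> real) set" where
  "pre_blocks \<theta> = {(a, b). 0 \<le> a \<and> a < b \<and> b \<le> \<theta>}"

definition post_blocks :: "real \<Rightarrow> (real \<times> real) set" where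
  "post_blocks \<theta> = {(a, b). \<theta> \<le> a \<and> a < b \<and> b \<le> 1}"

definition spectral_ceiling :: "'q::finite signal \<Rightarrow> real \<Rightarrow> ereal" where
  "spectral_ceiling y \<theta> =
     (SUP (a, b)\<in>br_blocks \<theta>. limsup (\<lambda>n. ereal (op_norm (second_moment y n a b))))"

definition spectral_floor :: "'q::finite signal \<Rightarrow> real \<Rightarrow> ereal" where
  "spectral_floor y \<theta> =
     (INF (a, b)\<in>cut_blocks \<theta>. liminf (\<lambda>n. ereal (lambda_min (second_moment y n a b))))"

definition moment_dist ::
  "'q::finite signal \<Rightarrow> nat \<Rightarrow> real \<times> real \<Rightarrow> real \<times> real \<Rightarrow> ereal" where
  "moment_dist y n p r =
     ereal (frob_norm (second_moment y n (fst p) (snd p) - second_moment y n (fst r) (snd r)))"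

definition delta_within :: "'q::finite signal \<Rightarrow> real \<Rightarrow> ereal" where
  "delta_within y \<theta> =
     (SUP (p, r)\<in>pre_blocks \<theta> \<times> pre_blocks \<theta> \<union> post_blocks \<theta> \<times> post_blocks \<theta>.
        limsup (\<lambda>n. moment_dist y n p r))"

definition delta_between :: "'q::finite signal \<Rightarrow> real \<Rightarrow> ereal" where
  "delta_between y \<theta> =
     (INF (p, r)\<in>pre_blocks \<theta> \<times> post_blocks \<theta>. liminf (\<lambda>n. moment_dist y n p r))"

text \<open>
  The logarithm with the convention \<open>log 0 = -\<infinity>\<close>. It is applied to determinants of positive
  semidefinite matrices only, so its value at negative arguments is irrelevant.
\<close>

definition log_ext :: "real \<Rightarrow> ereal" where
  "log_ext x = (if x \<le> 0 then -\<infinity> else ereal (ln x))"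

text \<open>
  The objective is meaningful when both blocks are nonempty, that is when
  \<open>1 \<le> \<lfloor>\<nu> n\<rfloor> \<le> n - 1\<close>. This holds at all grid points, and for fixed
  \<open>\<nu> \<in> (0, 1)\<close> for all large \<open>n\<close>.
\<close>

definition qml :: "'q::finite signal \<Rightarrow> real \<Rightarrow> nat \<Rightarrow> real \<Rightarrow> ereal" where
  "qml y \<epsilon> n \<nu> =
     ereal \<nu> * log_ext (det (second_moment y n 0 \<nu> + \<epsilon> *\<^sub>R mat 1))
     + ereal (1 - \<nu>) * log_ext (det (second_moment y n \<nu> 1 + \<epsilon> *\<^sub>R mat 1))"

definition grid :: "nat \<Rightarrow> real set" where
  "grid n = {real k / real n | k. 1 \<le> k \<and> k \<le> n - 1}"

definition trimmed_grid :: "real \<Rightarrow> nat \<Rightarrow> real set" where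
  "trimmed_grid \<delta> n = grid n \<inter> {\<delta>..1 - \<delta>}"

text \<open>
  A sequence of minimizers over the grids \<open>D n\<close>. Nothing is required at the finitely many
  \<open>n\<close> for which the grid is empty.
\<close>

definition minimizer_seq ::
  "'q::finite signal \<Rightarrow> real \<Rightarrow> (nat \<Rightarrow> real set) \<Rightarrow> (nat \<Rightarrow> real) \<Rightarrow> bool" where
  "minimizer_seq y \<epsilon> D h \<longleftrightarrow>
     (\<forall>n. D n \<noteq> {} \<longrightarrow> is_arg_min (qml y \<epsilon> n) (\<lambda>\<nu>. \<nu> \<in> D n) (h n))"

end

theory Submission
  imports Defs
begin

text \<open>
  For \<open>\<nu> < \<theta>\<close> let \<open>A\<close>, \<open>B\<close>, \<open>C\<close> be the regularized moments of the blocks \<open>(0, \<nu>)\<close>,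
  \<open>(\<nu>, \<theta>)\<close>, \<open>(\<theta>, 1)\<close>. Up to rounding, the moments of \<open>(0, \<theta>)\<close> and \<open>(\<nu>, 1)\<close> are
  weighted means of \<open>A, B\<close> and of \<open>B, C\<close>, so \<open>J(\<nu>) - J(\<theta>)\<close> is the Jensen gap of \<open>log det\<close> at
  \<open>B, C\<close> minus the gap at \<open>A, B\<close>. Along a segment the second derivative of \<open>log det\<close> lies between
  \<open>- (\<parallel>X - Y\<parallel> / k)\<^sup>2\<close> and \<open>- (\<parallel>X - Y\<parallel> / K)\<^sup>2\<close> when the spectra lie in \<open>[k, K]\<close>; hence the
  first gap is at least of order \<open>(D / K)\<^sup>2\<close> and the second at most of order \<open>(W / k)\<^sup>2\<close>, where \<open>D\<close>
  bounds the contrast between the regimes and \<open>W\<close> the fluctuation within them.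

  For consistency the pointwise bound is made locally uniform in \<open>\<nu>\<close> by comparing block sums in
  the Loewner order: for \<open>\<nu>\<close> in a short interval with right end \<open>s'\<close>, the moments at \<open>\<nu>\<close> dominate
  those at \<open>s'\<close> up to factors close to one. Finiteness of \<open>W\<close> excludes that mass concentrates in
  short blocks.
\<close>

section \<open>Symmetric matrices\<close>

text \<open>Both thresholds come from the weights of the two merges. These share the factor
  \<open>\<theta> - \<nu>\<close>; what remains is \<open>(1 - \<theta>) / (1 - \<nu>)\<close> in
  front of \<open>(D / K)^2\<close> and \<open>\<nu> / \<theta>\<close> in front of
  \<open>(W / k)^2\<close>. Near the break both tend to 1, which gives (i). The second divided by
  the first is \<open>\<nu> (1 - \<nu>) / (\<theta> (1 - \<theta>))\<close>, at most
  \<open>1 / (4 \<theta> (1 - \<theta>))\<close>, and the square root of this bound is the constant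
  in (ii). The gap at B, C is governed by the ceiling, the gap at A, B by the floor. This explains
  the different families of blocks behind \<open>K\<close> and \<open>k\<close>. The obstacle to
  consistency is that every hypothesis is a limit at fixed fractions, while a minimizer moves with n
  and its own blocks carry no bound. Near 0 or 1 only the regularization keeps log det from below,
  which is where \<open>\<epsilon> > 0\<close> enters for untrimmed estimators.\<close>

lemma self_adjoint_eigenvector:
  fixes f :: "'a::euclidean_space \<Rightarrow> 'a"
  assumes f: "linear f" "\<And>x y. f x \<bullet> y = x \<bullet> f y"
    and S: "subspace S" "f ` S \<subseteq> S" "S \<noteq> {0}"
  shows "\<exists>v\<in>S. norm v = 1 \<and> f v = (v \<bullet> f v) *\<^sub>R v"
proof -
  obtain u where u: "u \<in> S" "u \<noteq> 0"
    using S(1,3) subspace_0 by blast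
  let ?T = "S \<inter> sphere 0 1"
  have "u /\<^sub>R norm u \<in> ?T"
    using u S(1) by (auto intro: subspace_scale)
  moreover have "compact ?T"
    using S(1) by (simp add: closed_Int_compact closed_subspace)
  moreover have "continuous_on ?T (\<lambda>x. x \<bullet> f x)"
    using f(1) by (intro continuous_intros linear_continuous_on linear_conv_bounded_linear[THEN iffD1])
  ultimately obtain v where v: "v \<in> ?T" and max: "\<And>x. x \<in> ?T \<Longrightarrow> x \<bullet> f x \<le> v \<bullet> f v"
    using continuous_attains_sup[of ?T "\<lambda>x. x \<bullet> f x"] by blast
  define l where "l = v \<bullet> f v"
  have vS: "v \<in> S" and v1: "norm v = 1"
    using v by auto
  have vv: "v \<bullet> v = 1"
    using v1 by (simp add: norm_eq_1)
  have le: "x \<bullet> f x \<le> l * (x \<bullet> x)" if "x \<in> S" for x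
  proof (cases "x = 0")
    case True
    then show ?thesis using linear_0[OF f(1)] by simp
  next
    case False
    have "x /\<^sub>R norm x \<in> ?T"
      using that False S(1) by (auto intro: subspace_scale)
    from max[OF this] have "(x \<bullet> f x) / (norm x)\<^sup>2 \<le> l"
      by (simp add: linear_scale[OF f(1)] l_def power2_eq_square divide_simps)
    then show ?thesis
      using False by (simp add: pos_divide_le_eq dot_square_norm)
  qed
  \<comment> \<open>\<open>v\<close> maximizes the Rayleigh quotient on the unit sphere of
    \<open>S\<close>, so its first variation in every direction of \<open>S\<close> orthogonal to
    \<open>v\<close> vanishes.\<close>
  have orth: "w \<bullet> f v = 0" if w: "w \<in> S" "w \<bullet> v = 0" for w
  proof (rule ccontr)
    assume "w \<bullet> f v \<noteq> 0"
    define a where "a = w \<bullet> f v"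
    define b where "b = l * (w \<bullet> w) - w \<bullet> f w"
    have *: "2 * t * a \<le> t\<^sup>2 * b" for t
    proof -
      have "v + t *\<^sub>R w \<in> S"
        using vS w S(1) by (simp add: subspace_add subspace_scale)
      from le[OF this] have "(v + t *\<^sub>R w) \<bullet> f (v + t *\<^sub>R w) \<le> l * (1 + t\<^sup>2 * (w \<bullet> w))"
        using vv w by (simp add: inner_add_left inner_add_right inner_commute[of v w] power2_eq_square mult.assoc)
      moreover have "(v + t *\<^sub>R w) \<bullet> f (v + t *\<^sub>R w) = l + 2 * t * a + t\<^sup>2 * (w \<bullet> f w)"
        using f(2)[of v w] by (simp add: linear_add[OF f(1)] linear_scale[OF f(1)] inner_add_left
            inner_add_right l_def a_def power2_eq_square inner_commute[of "f v" w] algebra_simps)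
      ultimately show ?thesis by (simp add: b_def algebra_simps)
    qed
    have "b \<ge> 0"
      using le[OF w(1)] by (simp add: b_def)
    \<comment> \<open>With \<open>t = a / (b + 1)\<close> the linear term outweighs the quadratic
      one; the 1 is added because \<open>b\<close> may be zero.\<close>
    have "2 * (a / (b + 1)) * a \<le> (a / (b + 1))\<^sup>2 * b" by (rule *)
    moreover have "(a / (b + 1))\<^sup>2 * b = (a / (b + 1)) * a * (b / (b + 1))"
      by (simp add: power2_eq_square)
    moreover have "(a / (b + 1)) * a * (b / (b + 1)) \<le> (a / (b + 1)) * a * 1"
      using \<open>b \<ge> 0\<close> by (intro mult_left_mono) (auto simp: divide_simps)
    moreover have "(a / (b + 1)) * a > 0"
      using \<open>b \<ge> 0\<close> \<open>w \<bullet> f v \<noteq> 0\<close> by (auto simp: a_def zero_less_divide_iff zero_less_mult_iff)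
    ultimately show False by simp
  qed
  \<comment> \<open>The residual lies in \<open>S\<close> and is orthogonal to \<open>v\<close>,
    hence by \<open>orth\<close> to \<open>f v\<close>, and so to itself.\<close>
  let ?w = "f v - l *\<^sub>R v"
  have "?w \<in> S"
    using vS S by (auto intro!: subspace_diff subspace_scale)
  moreover have wv: "?w \<bullet> v = 0"
    using vv by (simp add: l_def inner_diff_left inner_commute[of "f v"])
  ultimately have "?w \<bullet> f v = 0" by (rule orth)
  then have "?w \<bullet> ?w = 0"
    using wv by (simp add: inner_diff_right)
  then show ?thesis
    using vS v1 by (auto simp: l_def)
qed

text \<open>Self-adjointness makes the orthogonal complement of an eigenvector inside
  \<open>S\<close> invariant again, so induction on the dimension applies. This is why invariant
  subspaces appear instead of the whole space.\<close>

theorem self_adjoint_eigenbasis: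
  fixes f :: "'a::euclidean_space \<Rightarrow> 'a"
  assumes f: "linear f" "\<And>x y. f x \<bullet> y = x \<bullet> f y"
    and "subspace S" "f ` S \<subseteq> S"
  shows "\<exists>B. finite B \<and> B \<subseteq> S \<and> span B = S \<and> pairwise orthogonal B \<and>
     (\<forall>v\<in>B. norm v = 1 \<and> f v = (v \<bullet> f v) *\<^sub>R v)"
  using assms(3,4)
proof (induction "dim S" arbitrary: S rule: less_induct)
  case less
  show ?case
  proof (cases "S = {0}")
    case True
    then show ?thesis by (intro exI[of _ "{}"]) auto
  next
    case False
    obtain v where v: "v \<in> S" "norm v = 1" "f v = (v \<bullet> f v) *\<^sub>R v"
      using self_adjoint_eigenvector[OF f less.prems False] by blast
    have vv: "v \<bullet> v = 1" using v by (simp add: norm_eq_1)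
    let ?S = "{x \<in> S. x \<bullet> v = 0}"
    have sub: "subspace ?S"
      using less.prems(1) by (auto simp: subspace_def inner_add_left)
    have "f x \<bullet> v = 0" if "x \<bullet> v = 0" for x
      using f(2)[of x v] v(3) that by (metis inner_scaleR_right mult_zero_right)
    then have inv: "f ` ?S \<subseteq> ?S"
      using less.prems(2) by auto
    have "v \<notin> ?S" using vv by auto
    then have "?S \<subset> S" using v(1) by blast
    then have "dim ?S < dim S"
      by (metis sub less.prems(1) dim_psubset span_eq_iff)
    from less.hyps[OF this sub inv] obtain B where B: "finite B" "B \<subseteq> ?S" "span B = ?S"
      "pairwise orthogonal B" "\<forall>v\<in>B. norm v = 1 \<and> f v = (v \<bullet> f v) *\<^sub>R v"
      by blast
    have "span (insert v B) = S"
    proof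
      show "span (insert v B) \<subseteq> S"
        using v(1) B(2) less.prems(1) by (intro span_minimal) auto
      show "S \<subseteq> span (insert v B)"
      proof
        fix x assume x: "x \<in> S"
        have "x - (x \<bullet> v) *\<^sub>R v \<in> ?S"
          using x v vv less.prems(1) by (auto intro: subspace_diff subspace_scale simp: inner_diff_left)
        then show "x \<in> span (insert v B)"
          using B(3) by (auto simp: span_insert)
      qed
    qed
    moreover have "pairwise orthogonal (insert v B)"
      using B(2,4) by (auto simp: pairwise_insert orthogonal_def inner_commute)
    ultimately show ?thesis
      using v B by (intro exI[of _ "insert v B"]) auto
  qed
qed

section \<open>Diagonal matrices and matrix arithmetic\<close>

definition diag :: "('n \<Rightarrow> real) \<Rightarrow> real ^ 'n ^ 'n" where
  "diag d = (\<chi> i j. if i = j then d i else 0)"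

lemma diag_mult_vec_nth [simp]: "(diag d *v x) $ i = d i * x $ i"
  by (simp add: diag_def matrix_vector_mult_def if_distrib[of "\<lambda>z. z * _"] cong: if_cong)

lemma transpose_diag [simp]: "transpose (diag d) = diag d"
  by (simp add: diag_def transpose_def vec_eq_iff)

lemma diag_mult_diag: "diag a ** diag b = diag (\<lambda>i. a i * b i)"
  by (simp add: matrix_eq vec_eq_iff flip: matrix_vector_mul_assoc)

lemma diag_add: "diag a + diag b = diag (\<lambda>i. a i + b i)"
  and diag_diff: "diag a - diag b = diag (\<lambda>i. a i - b i)"
  and diag_scaleR: "t *\<^sub>R diag a = diag (\<lambda>i. t * a i)"
  and diag_one: "diag (\<lambda>i. 1) = mat 1"
  by (simp_all add: diag_def vec_eq_iff mat_def)

lemma det_diag: "det (diag d) = (\<Prod>i\<in>UNIV. d i)"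
  by (subst det_diagonal) (auto simp: diag_def)

lemma norm_diag: "(norm (diag d))\<^sup>2 = (\<Sum>i\<in>UNIV. (d i)\<^sup>2)"
  unfolding power2_norm_eq_inner
  by (simp add: inner_vec_def diag_def power2_eq_square if_distrib[of "\<lambda>z. z * _"] cong: if_cong)

lemma transpose_add: "transpose (A + B) = transpose A + transpose (B :: real ^ 'm ^ 'n)"
  and transpose_scaleR: "transpose (c *\<^sub>R A) = c *\<^sub>R transpose (A :: real ^ 'm ^ 'n)"
  by (simp_all add: transpose_def vec_eq_iff)

lemma scaleR_matrix_vector_mult: "(c *\<^sub>R A) *v x = c *\<^sub>R ((A :: real ^ 'm ^ 'n) *v x)"
  by (simp add: matrix_vector_mult_def vec_eq_iff sum_distrib_left mult.assoc)

lemma matrix_mult_scaleR: "A ** (c *\<^sub>R B) = c *\<^sub>R (A ** (B :: real ^ 'm ^ 'n) :: real ^ 'm ^ 'l)"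
  and scaleR_matrix_mult: "(c *\<^sub>R C) ** B = c *\<^sub>R ((C :: real ^ 'n ^ 'l) ** (B :: real ^ 'm ^ 'n))"
  by (simp_all add: matrix_matrix_mult_def vec_eq_iff sum_distrib_left mult_ac)

lemma matrix_diff_mult_distrib: "(A - B) ** C = A ** C - (B :: real ^ 'n ^ 'l) ** (C :: real ^ 'm ^ 'n)"
  and matrix_mult_diff_distrib: "D ** (E - F) = D ** E - (D :: real ^ 'n ^ 'l) ** (F :: real ^ 'm ^ 'n)"
  by (simp_all add: matrix_matrix_mult_def vec_eq_iff sum_subtractf algebra_simps)

lemma matrix_add_mult_distrib: "(A + B) ** C = A ** C + (B :: real ^ 'n ^ 'l) ** (C :: real ^ 'm ^ 'n)"
  by (simp add: matrix_matrix_mult_def vec_eq_iff sum.distrib algebra_simps)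

lemma inner_transpose: "x \<bullet> (A *v y) = (transpose A *v x) \<bullet> (y :: real ^ 'n)"
  for A :: "real ^ 'n ^ 'm"
  by (simp add: dot_lmul_matrix[symmetric])

lemma det_scaleR: "det (c *\<^sub>R A) = c ^ CARD('n) * det A" for A :: "real ^ 'n ^ 'n"
proof -
  have "c *\<^sub>R A = diag (\<lambda>i. c) ** A"
    by (simp add: matrix_eq vec_eq_iff scaleR_matrix_vector_mult flip: matrix_vector_mul_assoc)
  then show ?thesis by (simp add: det_mul det_diag)
qed

theorem symmetric_diagonalization:
  fixes A :: "real ^ 'n ^ 'n"
  assumes "transpose A = A"
  obtains P d where "orthogonal_matrix P" "A = P ** diag d ** transpose P"
proof -
  have "(A *v x) \<bullet> y = x \<bullet> (A *v y)" for x y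
    using assms by (simp add: inner_transpose)
  then obtain B where B: "finite B" "span B = UNIV" "pairwise orthogonal B"
    "\<And>v. v \<in> B \<Longrightarrow> norm v = 1 \<and> A *v v = (v \<bullet> (A *v v)) *\<^sub>R v"
    using self_adjoint_eigenbasis[of "(*v) A" UNIV] by auto
  have "0 \<notin> B" using B(4) by fastforce
  then have "independent B"
    using B(3) pairwise_orthogonal_independent by blast
  then have "card B = CARD('n)"
    \<comment> \<open>An independent spanning set has as many elements as the index type, so the
      eigenvectors can be numbered by it and serve as the columns of \<open>P\<close>.\<close>
    using B(2) by (metis dim_UNIV dim_span_eq_card_independent DIM_cart DIM_real mult_1_right)
  then obtain f where f: "bij_betw f (UNIV :: 'n set) B"
    using B(1) by (metis finite_class.finite_UNIV finite_same_card_bij)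
  define P where "P = (\<chi> i j. f j $ i)"
  define d where "d j = f j \<bullet> (A *v f j)" for j
  have col: "column j P = f j" for j
    by (simp add: P_def column_def vec_eq_iff)
  have fB: "f j \<in> B" for j
    using f bij_betwE by blast
  have "orthogonal (f i) (f j)" if "i \<noteq> j" for i j
    using that f B(3) fB by (metis pairwiseD bij_betw_imp_inj_on injD)
  then have P: "orthogonal_matrix P"
    using fB B(4) by (simp add: orthogonal_matrix_orthonormal_columns col)
  have "A ** P = P ** diag d"
  proof -
    have "A *v f j = d j *\<^sub>R f j" for j
      using B(4)[OF fB[of j]] by (simp add: d_def)
    then have "(\<Sum>k\<in>UNIV. A $ i $ k * f j $ k) = d j * f j $ i" for i j
      by (simp add: vec_eq_iff matrix_vector_mult_def)
    then show ?thesis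
      by (simp add: vec_eq_iff matrix_matrix_mult_def P_def diag_def if_distrib[of "\<lambda>z. _ * z"]
          mult.commute cong: if_cong)
  qed
  then have "A = P ** diag d ** transpose P"
    using P by (metis matrix_mul_assoc matrix_mul_rid orthogonal_matrix_def)
  with P show ?thesis using that by blast
qed

text \<open>At an \<open>x\<close> with \<open>transpose L *v x = axis i 1\<close> the sum reduces
  to \<open>e i\<close>. In this way Loewner inequalities become inequalities between diagonal
  entries.\<close>

lemma inner_congruence_diag:
  "x \<bullet> ((L ** diag e ** transpose L) *v x) = (\<Sum>i\<in>UNIV. e i * ((transpose L *v x) $ i)\<^sup>2)"
  for L :: "real ^ 'n ^ 'n"
proof -
  have "x \<bullet> ((L ** diag e ** transpose L) *v x) = (transpose L *v x) \<bullet> (diag e *v (transpose L *v x))"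
    by (simp only: inner_transpose[of x L] flip: matrix_vector_mul_assoc)
  then show ?thesis
    by (simp add: inner_vec_def power2_eq_square algebra_simps)
qed

section \<open>The Loewner order\<close>

text \<open>A relation between quadratic forms only; symmetry is a separate hypothesis wherever a
  matrix is diagonalized.\<close>

definition loewner :: "real ^ 'n ^ 'n \<Rightarrow> real ^ 'n ^ 'n \<Rightarrow> bool" (infix "\<preceq>" 50) where
  "A \<preceq> B \<longleftrightarrow> (\<forall>x. x \<bullet> (A *v x) \<le> x \<bullet> (B *v x))"

lemma loewner_refl [simp]: "A \<preceq> A"
  by (simp add: loewner_def)

lemma loewner_trans [trans]: "A \<preceq> B \<Longrightarrow> B \<preceq> C \<Longrightarrow> A \<preceq> C"
  unfolding loewner_def using order_trans by blast

lemma loewner_add: "A \<preceq> B \<Longrightarrow> C \<preceq> D \<Longrightarrow> A + C \<preceq> B + D"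
  by (simp add: loewner_def matrix_vector_mult_add_rdistrib inner_add_right add_mono)

lemma loewner_scaleR: "A \<preceq> B \<Longrightarrow> 0 \<le> c \<Longrightarrow> c *\<^sub>R A \<preceq> c *\<^sub>R B"
  by (simp add: loewner_def scaleR_matrix_vector_mult mult_left_mono)

lemma loewner_scaleR_right: "0 \<preceq> A \<Longrightarrow> c \<le> d \<Longrightarrow> c *\<^sub>R A \<preceq> d *\<^sub>R A"
  by (simp add: loewner_def scaleR_matrix_vector_mult mult_right_mono)

lemma loewner_scaleR_mat: "c *\<^sub>R mat 1 \<preceq> A \<longleftrightarrow> (\<forall>x. c * (norm x)\<^sup>2 \<le> x \<bullet> (A *v x))"
  and loewner_mat_scaleR: "A \<preceq> c *\<^sub>R mat 1 \<longleftrightarrow> (\<forall>x. x \<bullet> (A *v x) \<le> c * (norm x)\<^sup>2)"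
  by (simp_all add: loewner_def scaleR_matrix_vector_mult power2_norm_eq_inner)

lemma loewner_0: "0 \<preceq> A \<longleftrightarrow> (\<forall>x. 0 \<le> x \<bullet> (A *v x))"
  by (simp add: loewner_def)

lemma loewner_0_mat: "0 \<le> c \<Longrightarrow> 0 \<preceq> c *\<^sub>R mat 1"
  by (simp add: loewner_def scaleR_matrix_vector_mult)

lemma loewner_mat_iff: "c *\<^sub>R mat 1 \<preceq> d *\<^sub>R (mat 1 :: real ^ 'n ^ 'n) \<longleftrightarrow> c \<le> d"
proof
  assume "c *\<^sub>R mat 1 \<preceq> d *\<^sub>R (mat 1 :: real ^ 'n ^ 'n)"
  then show "c \<le> d"
    by (auto simp: loewner_def scaleR_matrix_vector_mult dest!: spec[of _ "axis undefined 1"])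
qed (simp add: loewner_def scaleR_matrix_vector_mult mult_right_mono)

lemmas loewner_mat_mono = loewner_mat_iff[THEN iffD2]

text \<open>The bound by \<open>k\<close> makes \<open>X\<close> positive definite, so
  \<open>X = R ** transpose R\<close> with \<open>R\<close> invertible. \<open>Y\<close> is
  diagonalized in the frame of \<open>R\<close>, and rotating \<open>R\<close> accordingly leaves
  \<open>R ** transpose R\<close> unchanged.\<close>

theorem simultaneous_diagonalization:
  fixes X Y :: "real ^ 'n ^ 'n"
  assumes X: "transpose X = X" and Y: "transpose Y = Y" and k: "0 < k" "k *\<^sub>R mat 1 \<preceq> X"
  obtains L :: "real ^ 'n ^ 'n" and d where "invertible L" "X = L ** transpose L" "Y = L ** diag d ** transpose L"
proof -
  obtain P x where P: "orthogonal_matrix P" and Xeq: "X = P ** diag x ** transpose P"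
    using symmetric_diagonalization[OF X] by blast
  have PT: "transpose P ** P = mat 1" "P ** transpose P = mat 1"
    using P by (auto simp: orthogonal_matrix_def)
  have pos: "x i > 0" for i
  proof -
    let ?u = "P *v axis i 1"
    have PTu: "transpose P *v ?u = axis i 1"
      using PT by (simp add: matrix_vector_mul_assoc)
    then have "?u \<noteq> 0" by (metis axis_eq_0_iff matrix_vector_mult_0_right zero_neq_one)
    then have "0 < k * (norm ?u)\<^sup>2" using k by simp
    also have "\<dots> \<le> ?u \<bullet> (X *v ?u)"
      using k(2) by (simp only: loewner_scaleR_mat)
    also have "\<dots> = x i"
      unfolding Xeq inner_congruence_diag PTu
      by (simp add: axis_def if_distrib[of "\<lambda>z. z\<^sup>2"] if_distrib[of "\<lambda>z. _ * z"] cong: if_cong)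
    finally show ?thesis .
  qed
  define R where "R = P ** diag (\<lambda>i. sqrt (x i))"
  have "det P \<noteq> 0"
    using det_orthogonal_matrix[OF P] by auto
  then have R: "invertible R"
    using pos by (auto simp: R_def invertible_det_nz det_mul det_diag less_imp_neq[symmetric])
  have "diag (\<lambda>i. sqrt (x i)) ** diag (\<lambda>i. sqrt (x i)) = diag x"
    using pos by (simp add: diag_mult_diag less_imp_le)
  then have XR: "X = R ** transpose R"
    unfolding R_def Xeq matrix_transpose_mul transpose_diag by (metis matrix_mul_assoc)
  obtain R' where RI: "R ** R' = mat 1"
    using R by (auto simp: invertible_def)
  define Z where "Z = R' ** Y ** transpose R'"
  have "transpose Z = Z"
    by (simp add: Z_def matrix_transpose_mul Y matrix_mul_assoc)
  then obtain U d where U: "orthogonal_matrix U" and Z: "Z = U ** diag d ** transpose U"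
    using symmetric_diagonalization by blast
  have UT: "U ** transpose U = mat 1"
    using U by (simp add: orthogonal_matrix_def)
  from RI have RI': "transpose R' ** transpose R = mat 1"
    by (metis matrix_transpose_mul transpose_mat)
  let ?L = "R ** U"
  have "invertible ?L"
    using R det_orthogonal_matrix[OF U] by (auto simp: invertible_det_nz det_mul)
  moreover have "X = ?L ** transpose ?L"
    using UT by (metis XR matrix_mul_assoc matrix_mul_rid matrix_transpose_mul)
  moreover have "Y = ?L ** diag d ** transpose ?L"
  proof -
    have "?L ** diag d ** transpose ?L = R ** Z ** transpose R"
      by (simp add: Z matrix_transpose_mul matrix_mul_assoc)
    also have "\<dots> = (R ** R') ** Y ** (transpose R' ** transpose R)"
      by (simp add: Z_def matrix_mul_assoc)
    finally show ?thesis by (simp add: RI RI')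
  qed
  ultimately show ?thesis by (rule that)
qed

lemma loewner_diag_pos:
  fixes L :: "real ^ 'n ^ 'n"
  assumes L: "invertible L" and k: "0 < k" "k *\<^sub>R mat 1 \<preceq> L ** diag e ** transpose L"
  shows "0 < e i"
proof -
  obtain x where x: "transpose L *v x = axis i 1"
    using L by (metis invertible_def matrix_vector_mul_assoc matrix_vector_mul_lid transpose_mat matrix_transpose_mul)
  then have "x \<noteq> 0" by (metis axis_eq_0_iff matrix_vector_mult_0_right zero_neq_one)
  then have "0 < k * (norm x)\<^sup>2" using k by simp
  also have "\<dots> \<le> x \<bullet> ((L ** diag e ** transpose L) *v x)"
    using k(2) by (simp only: loewner_scaleR_mat)
  also have "\<dots> = e i"
    unfolding inner_congruence_diag x
    by (simp add: axis_def if_distrib[of "\<lambda>z. z\<^sup>2"] if_distrib[of "\<lambda>z. _ * z"] cong: if_cong)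
  finally show ?thesis .
qed

lemma det_congruence_diag: "det (L ** diag e ** transpose L) = (det L)\<^sup>2 * (\<Prod>i\<in>UNIV. e i)"
  for L :: "real ^ 'n ^ 'n"
  by (simp add: det_mul det_diag power2_eq_square)

lemma loewner_det_pos:
  fixes X :: "real ^ 'n ^ 'n"
  assumes "transpose X = X" "0 < k" "k *\<^sub>R mat 1 \<preceq> X"
  shows "0 < det X"
proof -
  obtain L :: "real ^ 'n ^ 'n" and d where L: "invertible L" "X = L ** transpose L"
    using simultaneous_diagonalization[OF assms(1,1,2,3)] by metis
  then show ?thesis
    using zero_less_power2[of "det L"] by (simp add: det_mul invertible_det_nz power2_eq_square)
qed

text \<open>In a common frame \<open>X\<close> is the identity and \<open>Y\<close> is
  \<open>diag d\<close>; the order then says that each \<open>d i\<close> is at least 1, hence so is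
  their product.\<close>

lemma loewner_det_mono:
  fixes X Y :: "real ^ 'n ^ 'n"
  assumes "transpose X = X" "transpose Y = Y" "0 < k" "k *\<^sub>R mat 1 \<preceq> X" "X \<preceq> Y"
  shows "det X \<le> det Y"
proof -
  obtain L :: "real ^ 'n ^ 'n" and d where L: "invertible L" "X = L ** transpose L" "Y = L ** diag d ** transpose L"
    using simultaneous_diagonalization[OF assms(1-4)] by metis
  have "1 \<le> d i" for i
  proof -
    obtain x where x: "transpose L *v x = axis i 1"
      using L(1) by (metis invertible_def matrix_vector_mul_assoc matrix_vector_mul_lid transpose_mat matrix_transpose_mul)
    have "X = L ** diag (\<lambda>i. 1) ** transpose L"
      by (simp add: L diag_one)
    moreover have "x \<bullet> (X *v x) \<le> x \<bullet> (Y *v x)"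
      using assms(5) by (simp add: loewner_def)
    ultimately have "x \<bullet> ((L ** diag (\<lambda>i. 1) ** transpose L) *v x) \<le> x \<bullet> ((L ** diag d ** transpose L) *v x)"
      using L(3) by metis
    then show ?thesis
      unfolding inner_congruence_diag x
      by (simp add: axis_def if_distrib[of "\<lambda>z. z\<^sup>2"] if_distrib[of "\<lambda>z. _ * z"] cong: if_cong)
  qed
  then have "1 \<le> (\<Prod>i\<in>UNIV. d i)"
    by (simp add: prod_ge_1)
  then have "(det L)\<^sup>2 * 1 \<le> (det L)\<^sup>2 * (\<Prod>i\<in>UNIV. d i)"
    by (intro mult_left_mono) auto
  then show ?thesis
    unfolding L(3) det_congruence_diag by (simp add: L(2) det_mul power2_eq_square)
qed

section \<open>Frobenius norms under congruence\<close>

lemma norm_matrix_columns: "(norm A)\<^sup>2 = (\<Sum>j\<in>UNIV. (norm (column j A))\<^sup>2)"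
  for A :: "real ^ 'm ^ 'n"
  unfolding power2_norm_eq_inner inner_vec_def column_def
  by (simp add: inner_vec_def) (rule sum.swap)

lemma norm_transpose: "norm (transpose A) = norm A" for A :: "real ^ 'm ^ 'n"
  unfolding norm_eq_sqrt_inner inner_vec_def transpose_def
  by (simp add: inner_vec_def) (rule sum.swap)

lemma column_matrix_mult: "column j (A ** B) = A *v column j B"
  by (simp add: column_def matrix_matrix_mult_def matrix_vector_mult_def vec_eq_iff)

text \<open>The hypothesis bounds \<open>transpose G\<close>. Cauchy-Schwarz, applied to
  \<open>(transpose G *v (G *v v)) \<bullet> v\<close>, carries the bound over to
  \<open>G\<close>.\<close>

lemma gram_upper:
  fixes G :: "real ^ 'n ^ 'n"
  assumes "0 \<le> K" "G ** transpose G \<preceq> K *\<^sub>R mat 1"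
  shows "(norm (G *v v))\<^sup>2 \<le> K * (norm v)\<^sup>2"
proof -
  have T: "(norm (transpose G *v x))\<^sup>2 \<le> K * (norm x)\<^sup>2" for x
  proof -
    have "(norm (transpose G *v x))\<^sup>2 = x \<bullet> ((G ** transpose G) *v x)"
      by (simp add: power2_norm_eq_inner inner_transpose[of x G] flip: matrix_vector_mul_assoc)
    then show ?thesis using assms(2) by (simp only: loewner_mat_scaleR)
  qed
  let ?a = "(norm (G *v v))\<^sup>2"
  have "?a = (transpose G *v (G *v v)) \<bullet> v"
    unfolding power2_norm_eq_inner by (subst inner_transpose) simp
  also have "\<dots> \<le> norm (transpose G *v (G *v v)) * norm v"
    by (rule norm_cauchy_schwarz)
  finally have "?a\<^sup>2 \<le> (norm (transpose G *v (G *v v)) * norm v)\<^sup>2"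
    by (intro power_mono) auto
  also have "\<dots> \<le> (K * ?a) * (norm v)\<^sup>2"
    unfolding power_mult_distrib by (intro mult_right_mono T) auto
  finally have "?a * ?a \<le> ?a * (K * (norm v)\<^sup>2)"
    by (simp add: power2_eq_square mult_ac)
  show ?thesis
  proof (cases "?a = 0")
    case False
    then have "0 < ?a" by simp
    with \<open>?a * ?a \<le> _\<close> show ?thesis
      by (simp only: mult_le_cancel_left_pos)
  qed (use assms(1) in simp)
qed

text \<open>With \<open>v = transpose G *v u\<close> the hypothesis bounds \<open>u\<close> in terms
  of \<open>v\<close>, and Cauchy-Schwarz for \<open>u \<bullet> (G *v v)\<close>, which is the
  squared norm of \<open>v\<close>, gives the claim.\<close>

lemma gram_lower:
  fixes G :: "real ^ 'n ^ 'n"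
  assumes "0 < k" "k *\<^sub>R mat 1 \<preceq> G ** transpose G" "invertible G"
  shows "k * (norm v)\<^sup>2 \<le> (norm (G *v v))\<^sup>2"
proof -
  obtain u where u: "v = transpose G *v u"
    using assms(3) by (metis invertible_def matrix_vector_mul_assoc matrix_vector_mul_lid transpose_mat matrix_transpose_mul)
  have "(norm v)\<^sup>2 = u \<bullet> ((G ** transpose G) *v u)"
    by (simp add: u power2_norm_eq_inner inner_transpose[of u G] flip: matrix_vector_mul_assoc)
  then have T: "k * (norm u)\<^sup>2 \<le> (norm v)\<^sup>2"
    using assms(2) by (simp only: loewner_scaleR_mat)
  have "(norm v)\<^sup>2 = u \<bullet> (G *v v)"
    by (simp only: inner_transpose power2_norm_eq_inner flip: u)
  also have "\<dots> \<le> norm u * norm (G *v v)"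
    by (rule norm_cauchy_schwarz)
  finally have "((norm v)\<^sup>2)\<^sup>2 \<le> (norm u * norm (G *v v))\<^sup>2"
    by (intro power_mono) auto
  then have "k * ((norm v)\<^sup>2)\<^sup>2 \<le> (k * (norm u)\<^sup>2) * (norm (G *v v))\<^sup>2"
    using assms(1) by (simp add: power_mult_distrib)
  also have "\<dots> \<le> (norm v)\<^sup>2 * (norm (G *v v))\<^sup>2"
    using T by (intro mult_right_mono) auto
  finally have "(norm v)\<^sup>2 * (k * (norm v)\<^sup>2) \<le> (norm v)\<^sup>2 * (norm (G *v v))\<^sup>2"
    by (simp add: power2_eq_square mult_ac)
  then show ?thesis
    using mult_le_cancel_left_pos[of "(norm v)\<^sup>2"] by (cases "v = 0") auto
qed

text \<open>The norm of a matrix is its Frobenius norm, so the bound on \<open>G\<close> applies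
  column by column. It is used once on the left and, after transposition, once on the right, each
  time at the cost of a factor \<open>K\<close>.\<close>

lemma norm_congruence_upper:
  fixes G Z :: "real ^ 'n ^ 'n"
  assumes "0 \<le> K" "G ** transpose G \<preceq> K *\<^sub>R mat 1"
  shows "(norm (G ** Z ** transpose G))\<^sup>2 \<le> K\<^sup>2 * (norm Z)\<^sup>2"
proof -
  have *: "(norm (G ** Y))\<^sup>2 \<le> K * (norm Y)\<^sup>2" for Y :: "real ^ 'n ^ 'n"
    unfolding norm_matrix_columns column_matrix_mult sum_distrib_left
    by (intro sum_mono gram_upper assms)
  have "(norm (G ** (Z ** transpose G)))\<^sup>2 \<le> K * (norm (Z ** transpose G))\<^sup>2" by (rule *)
  also have "norm (Z ** transpose G) = norm (G ** transpose Z)"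
    by (metis norm_transpose matrix_transpose_mul transpose_transpose)
  also have "K * (norm (G ** transpose Z))\<^sup>2 \<le> K * (K * (norm (transpose Z))\<^sup>2)"
    using assms(1) by (intro mult_left_mono *)
  finally show ?thesis
    by (simp add: norm_transpose matrix_mul_assoc power2_eq_square)
qed

lemma norm_congruence_lower:
  fixes G Z :: "real ^ 'n ^ 'n"
  assumes "0 < k" "k *\<^sub>R mat 1 \<preceq> G ** transpose G" "invertible G"
  shows "k\<^sup>2 * (norm Z)\<^sup>2 \<le> (norm (G ** Z ** transpose G))\<^sup>2"
proof -
  have *: "k * (norm Y)\<^sup>2 \<le> (norm (G ** Y))\<^sup>2" for Y :: "real ^ 'n ^ 'n"
    unfolding norm_matrix_columns column_matrix_mult sum_distrib_left
    by (intro sum_mono gram_lower assms)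
  have "k\<^sup>2 * (norm Z)\<^sup>2 = k * (k * (norm (transpose Z))\<^sup>2)"
    by (simp add: norm_transpose power2_eq_square)
  also have "\<dots> \<le> k * (norm (G ** transpose Z))\<^sup>2"
    using assms(1) by (intro mult_left_mono *) auto
  also have "norm (G ** transpose Z) = norm (Z ** transpose G)"
    by (metis norm_transpose matrix_transpose_mul transpose_transpose)
  also have "k * (norm (Z ** transpose G))\<^sup>2 \<le> (norm (G ** (Z ** transpose G)))\<^sup>2" by (rule *)
  finally show ?thesis
    by (simp add: matrix_mul_assoc)
qed

section \<open>The Jensen gap of the log-determinant\<close>

text \<open>\<open>- f t - c * t^2 / 2\<close> is convex, and the Jensen gap of \<open>t^2\<close>
  between 0 and 1 is \<open>w * (1 - w)\<close>.\<close>

lemma jensen_gap_ge: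
  fixes f :: "real \<Rightarrow> real"
  assumes f: "\<And>t. t \<in> {0..1} \<Longrightarrow> DERIV f t :> f' t" "\<And>t. t \<in> {0..1} \<Longrightarrow> DERIV f' t :> f'' t"
    and "\<And>t. t \<in> {0..1} \<Longrightarrow> f'' t \<le> - c" and w: "0 \<le> w" "w \<le> 1"
  shows "(1 - w) * f 0 + w * f 1 + c * (w * (1 - w)) / 2 \<le> f w"
proof -
  have "convex_on {0..1} (\<lambda>t. - f t - c * t\<^sup>2 / 2)"
  proof (rule f''_ge0_imp_convex)
    fix t :: real assume t: "t \<in> {0..1}"
    show "DERIV (\<lambda>t. - f t - c * t\<^sup>2 / 2) t :> - f' t - c * t"
      by (rule derivative_eq_intros f(1)[OF t] refl | simp)+
    show "DERIV (\<lambda>t. - f' t - c * t) t :> - f'' t - c"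
      by (rule derivative_eq_intros f(2)[OF t] refl | simp)+
    show "0 \<le> - f'' t - c"
      using assms(3)[OF t] by simp
  qed simp
  from convex_onD[OF this, of w 0 1] w show ?thesis
    by (simp add: power2_eq_square algebra_simps add_divide_distrib diff_divide_distrib)
qed

lemma jensen_gap_le:
  fixes f :: "real \<Rightarrow> real"
  assumes f: "\<And>t. t \<in> {0..1} \<Longrightarrow> DERIV f t :> f' t" "\<And>t. t \<in> {0..1} \<Longrightarrow> DERIV f' t :> f'' t"
    and "\<And>t. t \<in> {0..1} \<Longrightarrow> - c \<le> f'' t" and w: "0 \<le> w" "w \<le> 1"
  shows "f w \<le> (1 - w) * f 0 + w * f 1 + c * (w * (1 - w)) / 2"
proof -
  have "(1 - w) * (- f 0) + w * (- f 1) + (- c) * (w * (1 - w)) / 2 \<le> - f w"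
    using assms by (intro jensen_gap_ge[where f' = "\<lambda>t. - f' t" and f'' = "\<lambda>t. - f'' t"] DERIV_minus)
      (auto simp: minus_le_iff)
  then show ?thesis by simp
qed

text \<open>In a common frame the segment is \<open>L ** diag (e t) ** transpose L\<close> with
  affine entries, so log det is a constant plus a sum of logarithms of affine functions. Its second
  derivative is minus the squared norm of \<open>Y - X\<close> in a frame where the current matrix
  is the identity; the return to the original frame changes the norm by a factor between
  \<open>k\<close> and \<open>K\<close>.\<close>

theorem log_det_jensen_gap:
  fixes X Y :: "real ^ 'n ^ 'n"
  assumes sym: "transpose X = X" "transpose Y = Y"
    and k: "0 < k" "k *\<^sub>R mat 1 \<preceq> X" "k *\<^sub>R mat 1 \<preceq> Y"
    and K: "X \<preceq> K *\<^sub>R mat 1" "Y \<preceq> K *\<^sub>R mat 1" and w: "0 \<le> w" "w \<le> 1"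
  defines "gap \<equiv> ln (det ((1 - w) *\<^sub>R X + w *\<^sub>R Y)) - (1 - w) * ln (det X) - w * ln (det Y)"
  shows "w * (1 - w) * (norm (X - Y))\<^sup>2 / (2 * K\<^sup>2) \<le> gap"
    and "gap \<le> w * (1 - w) * (norm (X - Y))\<^sup>2 / (2 * k\<^sup>2)"
proof -
  obtain L :: "real ^ 'n ^ 'n" and d where L: "invertible L" "X = L ** transpose L" "Y = L ** diag d ** transpose L"
    using simultaneous_diagonalization[OF sym k(1,2)] by metis
  define e where "e t i = 1 + t * (d i - 1)" for t i
  define X' where "X' t = (1 - t) *\<^sub>R X + t *\<^sub>R Y" for t
  have X'L: "X' t = L ** diag (e t) ** transpose L" for t
  proof -
    have "X = L ** diag (\<lambda>i. 1) ** transpose L"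
      by (simp add: L diag_one)
    then have "X' t = L ** ((1 - t) *\<^sub>R diag (\<lambda>i. 1) + t *\<^sub>R diag d) ** transpose L"
      by (simp add: X'_def L(3) matrix_add_ldistrib matrix_add_mult_distrib matrix_mult_scaleR scaleR_matrix_mult)
    then show ?thesis
      by (simp add: diag_scaleR diag_add e_def[abs_def] algebra_simps)
  qed
  have bounds: "k *\<^sub>R mat 1 \<preceq> X' t" "X' t \<preceq> K *\<^sub>R mat 1" if "t \<in> {0..1}" for t
  proof -
    have "(1 - t) *\<^sub>R (k *\<^sub>R mat 1) + t *\<^sub>R (k *\<^sub>R mat 1) \<preceq> X' t"
      "X' t \<preceq> (1 - t) *\<^sub>R (K *\<^sub>R mat 1) + t *\<^sub>R (K *\<^sub>R mat 1)"
      unfolding X'_def by (intro loewner_add loewner_scaleR k K; use that in simp)+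
    then show "k *\<^sub>R mat 1 \<preceq> X' t" "X' t \<preceq> K *\<^sub>R mat 1"
      by (simp_all add: algebra_simps)
  qed
  have pos: "0 < e t i" if "t \<in> {0..1}" for t i
    using bounds(1)[OF that] L(1) k(1) unfolding X'L by (rule loewner_diag_pos[rotated 2])
  have detL: "0 < (det L)\<^sup>2"
    using L(1) by (simp add: invertible_det_nz)
  define f where "f t = ln ((det L)\<^sup>2) + (\<Sum>i\<in>UNIV. ln (e t i))" for t
  define f' where "f' t = (\<Sum>i\<in>UNIV. (d i - 1) / e t i)" for t
  define f'' where "f'' t = - (\<Sum>i\<in>UNIV. ((d i - 1) / e t i)\<^sup>2)" for t
  have f: "ln (det (X' t)) = f t" if "t \<in> {0..1}" for t
    unfolding X'L det_congruence_diag f_def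
    using detL pos[OF that] by (simp add: ln_mult prod_pos ln_prod less_imp_neq[symmetric])
  have de: "DERIV (\<lambda>t. e t i) t :> d i - 1" for t i
    unfolding e_def by (rule derivative_eq_intros refl | simp)+
  have f': "DERIV f t :> f' t" if "t \<in> {0..1}" for t
    unfolding f_def f'_def
    by (rule derivative_eq_intros DERIV_ln_divide[THEN DERIV_chain2] de pos[OF that] refl sum.cong | simp)+
  have f'': "DERIV f' t :> f'' t" if "t \<in> {0..1}" for t
  proof -
    have "DERIV (\<lambda>t. (d i - 1) / e t i) t :> - ((d i - 1) / e t i)\<^sup>2" for i
      by (rule derivative_eq_intros de refl | use pos[OF that, of i] in \<open>simp add: power2_eq_square\<close>)+
    then have "DERIV f' t :> (\<Sum>i\<in>UNIV. - ((d i - 1) / e t i)\<^sup>2)"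
      unfolding f'_def by (intro DERIV_sum) auto
    then show ?thesis by (simp add: f''_def sum_negf)
  qed
  have "0 < K"
  proof -
    have "k \<le> K"
      using loewner_trans[OF k(2) K(1)]
      by (simp only: loewner_mat_iff)
    then show ?thesis using k(1) by simp
  qed
  have ineq: "k\<^sup>2 * (- f'' t) \<le> (norm (X - Y))\<^sup>2 \<and> (norm (X - Y))\<^sup>2 \<le> K\<^sup>2 * (- f'' t)"
    if t: "t \<in> {0..1}" for t
  proof -
    \<comment> \<open>\<open>G\<close> is a factor of the current matrix \<open>X' t\<close>, and
      \<open>Z\<close> is the difference \<open>Y - X\<close> expressed in the frame of
      \<open>G\<close>.\<close>
    define G where "G = L ** diag (\<lambda>i. sqrt (e t i))"
    define Z where "Z = diag (\<lambda>i. (d i - 1) / e t i)"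
    have GG: "G ** transpose G = X' t"
    proof -
      have "diag (\<lambda>i. sqrt (e t i)) ** diag (\<lambda>i. sqrt (e t i)) = diag (e t)"
        using pos[OF t] by (simp add: diag_mult_diag less_imp_le)
      then show ?thesis
        unfolding G_def X'L matrix_transpose_mul transpose_diag by (metis matrix_mul_assoc)
    qed
    have "sqrt (e t i) * ((d i - 1) / e t i) * sqrt (e t i) = d i - 1" for i
    proof -
      have "sqrt (e t i) * ((d i - 1) / e t i) * sqrt (e t i) = (sqrt (e t i))\<^sup>2 * ((d i - 1) / e t i)"
        by (simp add: power2_eq_square)
      then show ?thesis using pos[OF t, of i] by simp
    qed
    then have "diag (\<lambda>i. sqrt (e t i)) ** Z ** diag (\<lambda>i. sqrt (e t i)) = diag (\<lambda>i. d i - 1)"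
      by (simp add: Z_def diag_mult_diag)
    then have "G ** Z ** transpose G = L ** diag (\<lambda>i. d i - 1) ** transpose L"
      unfolding G_def matrix_transpose_mul transpose_diag by (metis matrix_mul_assoc)
    also have "\<dots> = Y - X"
      by (simp add: L diag_one matrix_mult_diff_distrib matrix_diff_mult_distrib flip: diag_diff)
    finally have GZ: "norm (G ** Z ** transpose G) = norm (X - Y)"
      by (simp add: norm_minus_commute)
    have "invertible G"
      using L(1) pos[OF t] by (auto simp: G_def invertible_det_nz det_mul det_diag less_imp_neq[symmetric])
    moreover have "(norm Z)\<^sup>2 = - f'' t"
      by (simp add: Z_def norm_diag f''_def)
    ultimately show ?thesis
      using norm_congruence_upper[of K G Z] norm_congruence_lower[of k G Z] bounds[OF t] k(1) \<open>0 < K\<close> GG GZ by simp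
  qed
  have gap: "gap = f w - (1 - w) * f 0 - w * f 1"
    using f[of w] f[of 0] f[of 1] w by (simp add: gap_def X'_def)
  have "(1 - w) * f 0 + w * f 1 + ((norm (X - Y))\<^sup>2 / K\<^sup>2) * (w * (1 - w)) / 2 \<le> f w"
  proof (rule jensen_gap_ge[OF f' f'' _ w])
    show "f'' t \<le> - ((norm (X - Y))\<^sup>2 / K\<^sup>2)" if "t \<in> {0..1}" for t
      using ineq[OF that] \<open>0 < K\<close> by (simp add: field_simps)
  qed
  then show "w * (1 - w) * (norm (X - Y))\<^sup>2 / (2 * K\<^sup>2) \<le> gap"
    unfolding gap by (simp add: field_simps)
  have "f w \<le> (1 - w) * f 0 + w * f 1 + ((norm (X - Y))\<^sup>2 / k\<^sup>2) * (w * (1 - w)) / 2"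
  proof (rule jensen_gap_le[OF f' f'' _ w])
    show "- ((norm (X - Y))\<^sup>2 / k\<^sup>2) \<le> f'' t" if "t \<in> {0..1}" for t
      using ineq[OF that] k(1) by (simp add: field_simps)
  qed
  then show "gap \<le> w * (1 - w) * (norm (X - Y))\<^sup>2 / (2 * k\<^sup>2)"
    unfolding gap by (simp add: field_simps)
qed

lemma norm_matrix_vector_mult_le: "norm (A *v x) \<le> norm A * norm x" for A :: "real ^ 'm ^ 'n"
proof -
  have "(norm (A *v x))\<^sup>2 = (\<Sum>i\<in>UNIV. (A $ i \<bullet> x)\<^sup>2)"
    unfolding power2_norm_eq_inner
    by (simp add: inner_vec_def matrix_vector_mult_def power2_eq_square)
  also have "\<dots> \<le> (\<Sum>i\<in>UNIV. (norm (A $ i))\<^sup>2 * (norm x)\<^sup>2)"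
    by (intro sum_mono) (metis Cauchy_Schwarz_ineq power2_norm_eq_inner)
  also have "\<dots> = (norm A * norm x)\<^sup>2"
    by (simp add: power_mult_distrib flip: sum_distrib_right)
      (simp add: power2_norm_eq_inner inner_vec_def)
  finally show ?thesis
    by (rule power2_le_imp_le) auto
qed

lemma loewner_norm: "A \<preceq> norm A *\<^sub>R mat 1" for A :: "real ^ 'n ^ 'n"
  unfolding loewner_mat_scaleR
proof
  fix x
  have "x \<bullet> (A *v x) \<le> norm x * norm (A *v x)"
    by (rule norm_cauchy_schwarz)
  also have "\<dots> \<le> norm x * (norm A * norm x)"
    by (intro mult_left_mono norm_matrix_vector_mult_le) auto
  finally show "x \<bullet> (A *v x) \<le> norm A * (norm x)\<^sup>2"
    by (simp add: power2_eq_square mult_ac)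
qed

lemma loewner_scaleR_cancel: "0 < c \<Longrightarrow> c *\<^sub>R A \<preceq> c *\<^sub>R B \<longleftrightarrow> A \<preceq> B"
  by (simp add: loewner_def scaleR_matrix_vector_mult)

lemma det_scaleR_mat: "det (c *\<^sub>R (mat 1 :: real ^ 'n ^ 'n)) = c ^ CARD('n)"
  by (simp add: det_scaleR)

lemma transpose_scaleR_mat [simp]: "transpose (c *\<^sub>R mat 1) = (c *\<^sub>R mat 1 :: real ^ 'n ^ 'n)"
  by (simp add: transpose_scaleR)

section \<open>Log-determinants under Loewner bounds\<close>

lemma loewner_ln_det_ge:
  fixes X :: "real ^ 'n ^ 'n"
  assumes "transpose X = X" "0 < k" "k *\<^sub>R mat 1 \<preceq> X"
  shows "CARD('n) * ln k \<le> ln (det X)"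
proof -
  have "k ^ CARD('n) \<le> det X"
    using loewner_det_mono[of "k *\<^sub>R mat 1" X k] assms by (simp add: det_scaleR_mat)
  then have "ln (k ^ CARD('n)) \<le> ln (det X)"
    using assms loewner_det_pos[OF assms] by (intro ln_mono) auto
  then show ?thesis using assms(2) by (simp add: ln_realpow)
qed

lemma loewner_ln_det_le:
  fixes X :: "real ^ 'n ^ 'n"
  assumes "transpose X = X" "0 < k" "k *\<^sub>R mat 1 \<preceq> X" "X \<preceq> K *\<^sub>R mat 1"
  shows "ln (det X) \<le> CARD('n) * ln K"
proof -
  have "k \<le> K"
    using loewner_trans[OF assms(3,4)]
    by (simp only: loewner_mat_iff)
  then have "0 < K" using assms by simp
  have "det X \<le> K ^ CARD('n)"
    using loewner_det_mono[of X "K *\<^sub>R mat 1" k] assms by (simp add: det_scaleR_mat)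
  then have "ln (det X) \<le> ln (K ^ CARD('n))"
    using \<open>0 < K\<close> loewner_det_pos[OF assms(1-3)] by (intro ln_mono) auto
  then show ?thesis using \<open>0 < K\<close> by (simp add: ln_realpow)
qed

text \<open>\<open>Z\<close> will be a moment at a moving cut point, for which no spectral bound is
  at hand. Dominating a multiple of \<open>X\<close> makes its determinant positive and so excludes
  the value minus infinity.\<close>

lemma log_ext_det_ge:
  fixes X Z :: "real ^ 'n ^ 'n"
  assumes "transpose X = X" "transpose Z = Z" "0 < k" "k *\<^sub>R mat 1 \<preceq> X" "0 < r" "r *\<^sub>R X \<preceq> Z"
  shows "ereal (ln (det X) + CARD('n) * ln r) \<le> log_ext (det Z)"
proof -
  have "(r * k) *\<^sub>R mat 1 \<preceq> r *\<^sub>R X"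
    using loewner_scaleR[OF assms(4), of r] assms(5) by simp
  then have "det (r *\<^sub>R X) \<le> det Z"
    using assms by (intro loewner_det_mono[where k = "r * k"]) (auto simp: transpose_scaleR)
  then have le: "r ^ CARD('n) * det X \<le> det Z"
    by (simp add: det_scaleR)
  moreover have pos: "0 < r ^ CARD('n) * det X"
    using loewner_det_pos[OF assms(1,3,4)] assms(5) by simp
  ultimately have "ln (r ^ CARD('n) * det X) \<le> ln (det Z)"
    by (intro ln_mono) auto
  moreover have "ln (r ^ CARD('n) * det X) = ln (det X) + CARD('n) * ln r"
    using loewner_det_pos[OF assms(1,3,4)] assms(5) by (simp add: ln_mult ln_realpow)
  ultimately show ?thesis
    using le pos by (simp add: log_ext_def)
qed

section \<open>Families of block moments\<close>

text \<open>
  \<open>N a b n\<close> and \<open>S a b n\<close> stand for the size of the block with fractions \<open>a < b\<close> and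
  for the sum of the outer products over it. Only additivity is used, not the floor convention, so
  that the family read backwards in time is again of this kind.
\<close>

locale block_family =
  fixes N :: "real \<Rightarrow> real \<Rightarrow> nat \<Rightarrow> real"
    and S :: "real \<Rightarrow> real \<Rightarrow> nat \<Rightarrow> real ^ 'q ^ 'q"
    and \<epsilon> :: real
  assumes N_add: "0 \<le> a \<Longrightarrow> a \<le> b \<Longrightarrow> b \<le> c \<Longrightarrow> c \<le> 1 \<Longrightarrow> N a c n = N a b n + N b c n"
    and S_add: "0 \<le> a \<Longrightarrow> a \<le> b \<Longrightarrow> b \<le> c \<Longrightarrow> c \<le> 1 \<Longrightarrow> S a c n = S a b n + S b c n"
    and N_nonneg: "0 \<le> N a b n"
    and S_sym: "transpose (S a b n) = S a b n"
    and S_psd: "0 \<preceq> S a b n"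
    and S_empty: "N a b n = 0 \<Longrightarrow> S a b n = 0"
    and N_lim: "0 \<le> a \<Longrightarrow> a \<le> b \<Longrightarrow> b \<le> 1 \<Longrightarrow> (\<lambda>n. N a b n / n) \<longlonglongrightarrow> b - a"
    and eps: "0 \<le> \<epsilon>"
begin

definition Y :: "real \<Rightarrow> real \<Rightarrow> nat \<Rightarrow> real ^ 'q ^ 'q" where
  "Y a b n = (1 / N a b n) *\<^sub>R S a b n + \<epsilon> *\<^sub>R mat 1"

definition ld :: "real \<Rightarrow> real \<Rightarrow> nat \<Rightarrow> real" where
  "ld a b n = ln (det (Y a b n))"

definition obj :: "nat \<Rightarrow> real \<Rightarrow> ereal" where
  "obj n \<nu> = ereal \<nu> * log_ext (det (Y 0 \<nu> n)) + ereal (1 - \<nu>) * log_ext (det (Y \<nu> 1 n))"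

text \<open>Real-valued substitute for \<open>obj\<close>; the two agree wherever both determinants
  are positive.\<close>

definition robj :: "nat \<Rightarrow> real \<Rightarrow> real" where
  "robj n \<nu> = \<nu> * ld 0 \<nu> n + (1 - \<nu>) * ld \<nu> 1 n"

lemma Y_sym: "transpose (Y a b n) = Y a b n"
  by (simp add: Y_def transpose_add transpose_scaleR S_sym)

lemma Y_eps: "\<epsilon> *\<^sub>R mat 1 \<preceq> Y a b n"
proof -
  have "0 + \<epsilon> *\<^sub>R mat 1 \<preceq> Y a b n"
    unfolding Y_def using loewner_scaleR[OF S_psd, of "1 / N a b n"] N_nonneg
    by (intro loewner_add) auto
  then show ?thesis by simp
qed

lemma Y_psd: "0 \<preceq> Y a b n"
  using loewner_trans[OF loewner_0_mat[OF eps] Y_eps] .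

lemma N_mono:
  assumes "0 \<le> a" "a \<le> a'" "a' \<le> b'" "b' \<le> b" "b \<le> 1"
  shows "N a' b' n \<le> N a b n"
  using N_add[of a a' b n] N_add[of a' b' b n] N_nonneg[of a a' n] N_nonneg[of b' b n] assms by simp

text \<open>Multiplied by the size, the regularized moment becomes additive over blocks,
  \<open>\<epsilon>\<close> being counted once per observation. For an empty block both sides
  vanish, the left because of the factor, the right by \<open>S_empty\<close>.\<close>

lemma N_scale_Y: "N a b n *\<^sub>R Y a b n = S a b n + (N a b n * \<epsilon>) *\<^sub>R mat 1"
  by (cases "N a b n = 0") (auto simp: Y_def scaleR_add_right S_empty)

lemma Y_add:
  assumes "0 \<le> a" "a \<le> b" "b \<le> c" "c \<le> 1"
  shows "N a c n *\<^sub>R Y a c n = N a b n *\<^sub>R Y a b n + N b c n *\<^sub>R Y b c n"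
  unfolding N_scale_Y unfolding N_add[OF assms] S_add[OF assms] by (simp add: algebra_simps)

lemma Y_scale_mono:
  assumes "0 \<le> a" "a \<le> a'" "a' \<le> b'" "b' \<le> b" "b \<le> 1"
  shows "N a' b' n *\<^sub>R Y a' b' n \<preceq> N a b n *\<^sub>R Y a b n"
proof -
  have psd: "0 \<preceq> N u v n *\<^sub>R Y u v n" for u v
    using loewner_scaleR[OF Y_psd N_nonneg] by simp
  have "0 + (N a' b' n *\<^sub>R Y a' b' n + 0) \<preceq> N a a' n *\<^sub>R Y a a' n + (N a' b' n *\<^sub>R Y a' b' n + N b' b n *\<^sub>R Y b' b n)"
    by (intro loewner_add psd loewner_refl)
  also have "\<dots> = N a b n *\<^sub>R Y a b n"
    using assms by (simp add: Y_add[of a a' b] Y_add[of a' b' b])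
  finally show ?thesis by simp
qed

lemma N_pos: "0 \<le> a \<Longrightarrow> a < b \<Longrightarrow> b \<le> 1 \<Longrightarrow> \<forall>\<^sub>F n in sequentially. 0 < N a b n"
proof -
  assume "0 \<le> a" "a < b" "b \<le> 1"
  then have "\<forall>\<^sub>F n in sequentially. 0 < N a b n / n"
    using N_lim[of a b] by (intro order_tendstoD(1)[where y = "b - a"]) auto
  then show ?thesis
    by eventually_elim (auto simp: zero_less_divide_iff)
qed

lemma merge_bounds:
  assumes "0 \<le> a" "a \<le> b" "b \<le> c" "c \<le> 1" "0 < N a c n"
  shows "k *\<^sub>R mat 1 \<preceq> Y a b n \<Longrightarrow> k *\<^sub>R mat 1 \<preceq> Y b c n \<Longrightarrow> k *\<^sub>R mat 1 \<preceq> Y a c n"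
    and "Y a b n \<preceq> K *\<^sub>R mat 1 \<Longrightarrow> Y b c n \<preceq> K *\<^sub>R mat 1 \<Longrightarrow> Y a c n \<preceq> K *\<^sub>R mat 1"
proof -
  have eq: "N a c n *\<^sub>R (k *\<^sub>R mat 1) = N a b n *\<^sub>R (k *\<^sub>R mat 1) + N b c n *\<^sub>R (k *\<^sub>R (mat 1 :: real ^ 'q ^ 'q))" for k
    by (simp only: N_add[OF assms(1-4)] scaleR_add_left)
  show "k *\<^sub>R mat 1 \<preceq> Y a c n" if "k *\<^sub>R mat 1 \<preceq> Y a b n" "k *\<^sub>R mat 1 \<preceq> Y b c n"
    using assms(5) loewner_add[OF loewner_scaleR[OF that(1) N_nonneg[of a b n]] loewner_scaleR[OF that(2) N_nonneg[of b c n]]]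
    unfolding Y_add[OF assms(1-4), symmetric] eq[symmetric] by (simp only: loewner_scaleR_cancel)
  show "Y a c n \<preceq> K *\<^sub>R mat 1" if "Y a b n \<preceq> K *\<^sub>R mat 1" "Y b c n \<preceq> K *\<^sub>R mat 1"
    using assms(5) loewner_add[OF loewner_scaleR[OF that(1) N_nonneg[of a b n]] loewner_scaleR[OF that(2) N_nonneg[of b c n]]]
    unfolding Y_add[OF assms(1-4), symmetric] eq[symmetric] by (simp only: loewner_scaleR_cancel)
qed

text \<open>The merged moment is the mean with weights \<open>N a b n / N a c n\<close> and
  \<open>N b c n / N a c n\<close>. Multiplication by \<open>N a c n\<close> turns the Jensen weight
  \<open>w * (1 - w)\<close> into the factor in \<open>p\<close>. Sizes are exact here; rounding
  appears only when they are compared with fractions.\<close>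

lemma merge_gap:
  assumes abc: "0 \<le> a" "a \<le> b" "b \<le> c" "c \<le> 1" "0 < N a c n"
    and k: "0 < k" "k *\<^sub>R mat 1 \<preceq> Y a b n" "k *\<^sub>R mat 1 \<preceq> Y b c n"
    and K: "Y a b n \<preceq> K *\<^sub>R mat 1" "Y b c n \<preceq> K *\<^sub>R mat 1"
  defines "g \<equiv> N a c n * ld a c n - N a b n * ld a b n - N b c n * ld b c n"
    and "p \<equiv> N a b n * N b c n / N a c n * (norm (Y a b n - Y b c n))\<^sup>2"
  shows "p / (2 * K\<^sup>2) \<le> g" "g \<le> p / (2 * k\<^sup>2)"
proof -
  let ?w = "N b c n / N a c n"
  have w: "0 \<le> ?w" "1 - ?w = N a b n / N a c n" "?w \<le> 1"
    using N_add[OF abc(1-4), of n] abc(5) N_nonneg[of a b n] N_nonneg[of b c n]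
    by (auto simp: field_simps)
  have "N a c n *\<^sub>R Y a c n = N a c n *\<^sub>R ((1 - ?w) *\<^sub>R Y a b n + ?w *\<^sub>R Y b c n)"
    using abc(5) unfolding Y_add[OF abc(1-4)] w(2) by (simp add: scaleR_add_right)
  then have Y: "(1 - ?w) *\<^sub>R Y a b n + ?w *\<^sub>R Y b c n = Y a c n"
    using abc(5) by simp
  let ?gap = "ln (det (Y a c n)) - (1 - ?w) * ln (det (Y a b n)) - ?w * ln (det (Y b c n))"
  let ?q = "?w * (1 - ?w) * (norm (Y a b n - Y b c n))\<^sup>2"
  have "?q / (2 * K\<^sup>2) \<le> ?gap" "?gap \<le> ?q / (2 * k\<^sup>2)"
    using log_det_jensen_gap[OF Y_sym Y_sym k K w(1,3)] unfolding Y by simp_all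
  then have "N a c n * (?q / (2 * K\<^sup>2)) \<le> N a c n * ?gap" "N a c n * ?gap \<le> N a c n * (?q / (2 * k\<^sup>2))"
    using abc(5) by (simp_all only: mult_le_cancel_left_pos)
  moreover have "N a c n * ?gap = g"
    unfolding w(2) g_def ld_def using abc(5) by (simp add: field_simps)
  moreover have "N a c n * (?q / x) = p / x" for x
    unfolding w(2) p_def using abc(5) by (simp add: field_simps)
  ultimately show "p / (2 * K\<^sup>2) \<le> g" "g \<le> p / (2 * k\<^sup>2)"
    by simp_all
qed

lemma obj_eq_robj:
  assumes "0 < k" "k *\<^sub>R mat 1 \<preceq> Y 0 \<nu> n" "k *\<^sub>R mat 1 \<preceq> Y \<nu> 1 n"
  shows "obj n \<nu> = ereal (robj n \<nu>)"
  using loewner_det_pos[OF Y_sym assms(1,2)] loewner_det_pos[OF Y_sym assms(1,3)]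
  by (simp add: obj_def robj_def log_ext_def ld_def)

lemma abs_ld_le:
  assumes "0 < k" "k *\<^sub>R mat 1 \<preceq> Y a b n" "Y a b n \<preceq> K *\<^sub>R mat 1"
  shows "\<bar>ld a b n\<bar> \<le> CARD('q) * (\<bar>ln k\<bar> + \<bar>ln K\<bar>)"
proof -
  have "CARD('q) * ln k \<le> ld a b n" "ld a b n \<le> CARD('q) * ln K"
    unfolding ld_def using loewner_ln_det_ge[OF Y_sym assms(1,2)] loewner_ln_det_le[OF Y_sym assms] by auto
  moreover have "CARD('q) * ln K \<le> CARD('q) * (\<bar>ln k\<bar> + \<bar>ln K\<bar>)" "- (CARD('q) * (\<bar>ln k\<bar> + \<bar>ln K\<bar>)) \<le> CARD('q) * ln k"
    by (auto intro!: mult_left_mono simp flip: mult_minus_right)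
  ultimately show ?thesis by linarith
qed

lemma reflect: "block_family (\<lambda>a b. N (1 - b) (1 - a)) (\<lambda>a b. S (1 - b) (1 - a)) \<epsilon>"
proof
  fix a b c :: real and n
  assume "0 \<le> a" "a \<le> b" "b \<le> c" "c \<le> 1"
  then show "N (1 - c) (1 - a) n = N (1 - b) (1 - a) n + N (1 - c) (1 - b) n"
    "S (1 - c) (1 - a) n = S (1 - b) (1 - a) n + S (1 - c) (1 - b) n"
    using N_add[of "1 - c" "1 - b" "1 - a" n] S_add[of "1 - c" "1 - b" "1 - a" n] by auto
next
  fix a b :: real
  assume "0 \<le> a" "a \<le> b" "b \<le> 1"
  then show "(\<lambda>n. N (1 - b) (1 - a) n / n) \<longlonglongrightarrow> b - a"
    using N_lim[of "1 - b" "1 - a"] by simp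
qed (use N_nonneg S_sym S_psd S_empty eps in auto)

end

lemma mult_abs_bounds:
  fixes x y L :: real
  assumes "\<bar>y\<bar> \<le> L"
  shows "- (\<bar>x\<bar> * L) \<le> x * y" "x * y \<le> \<bar>x\<bar> * L"
proof -
  have "\<bar>x * y\<bar> \<le> \<bar>x\<bar> * L"
    unfolding abs_mult using assms by (intro mult_left_mono) auto
  then show "- (\<bar>x\<bar> * L) \<le> x * y" "x * y \<le> \<bar>x\<bar> * L" by linarith+
qed

text \<open>
  Slightly relaxed real versions of the four extremal quantities: \<open>k\<close> below the spectral floor
  plus \<open>\<epsilon>\<close>, \<open>K\<close> above the spectral ceiling plus \<open>\<epsilon>\<close>, \<open>W\<close> above the within-regime
  fluctuation and \<open>D\<close> below the between-regime contrast. The slack turns the limits into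
  eventual bounds.
\<close>

locale contrast = block_family N S \<epsilon>
  for N :: "real \<Rightarrow> real \<Rightarrow> nat \<Rightarrow> real"
    and S :: "real \<Rightarrow> real \<Rightarrow> nat \<Rightarrow> real ^ 'q ^ 'q" and \<epsilon> :: real +
  fixes \<theta> k K W D :: real
  assumes theta: "0 < \<theta>" "\<theta> < 1" and k_pos: "0 < k" and W_nonneg: "0 \<le> W" and D_nonneg: "0 \<le> D"
    and lower: "(a, b) \<in> cut_blocks \<theta> \<Longrightarrow> \<forall>\<^sub>F n in sequentially. k *\<^sub>R mat 1 \<preceq> Y a b n"
    and upper: "(a, b) \<in> br_blocks \<theta> \<Longrightarrow> \<forall>\<^sub>F n in sequentially. Y a b n \<preceq> K *\<^sub>R mat 1"
    and within: "(a, b) \<in> pre_blocks \<theta> \<and> (c, d) \<in> pre_blocks \<theta> \<or> (a, b) \<in> post_blocks \<theta> \<and> (c, d) \<in> post_blocks \<theta>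
      \<Longrightarrow> \<forall>\<^sub>F n in sequentially. norm (Y a b n - Y c d n) \<le> W"
    and between: "(a, b) \<in> pre_blocks \<theta> \<Longrightarrow> (c, d) \<in> post_blocks \<theta>
      \<Longrightarrow> \<forall>\<^sub>F n in sequentially. D \<le> norm (Y a b n - Y c d n)"
begin

text \<open>The coarse ceiling \<open>K + W\<close> also covers blocks without an end at the break.
  It enters only through \<open>LB\<close> and through factors multiplied by short block lengths, so
  the thresholds of the theorem keep the sharp \<open>K\<close>.\<close>

definition bd :: "real \<Rightarrow> real \<Rightarrow> nat \<Rightarrow> bool" where
  "bd a b n \<longleftrightarrow> 0 < N a b n \<and> k *\<^sub>R mat 1 \<preceq> Y a b n \<and> Y a b n \<preceq> (K + W) *\<^sub>R mat 1"

definition LB :: real where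
  "LB = CARD('q) * (\<bar>ln k\<bar> + \<bar>ln (K + W)\<bar>)"

lemma LB_nonneg: "0 \<le> LB"
  by (simp add: LB_def)

lemma bd_ld: "bd a b n \<Longrightarrow> \<bar>ld a b n\<bar> \<le> LB"
  unfolding bd_def LB_def using abs_ld_le[OF k_pos] by blast

lemma k_le_K: "k \<le> K"
proof -
  have "(0, \<theta>) \<in> br_blocks \<theta>" "(0, \<theta>) \<in> cut_blocks \<theta>"
    using theta by (auto simp: br_blocks_def cut_blocks_def)
  from eventually_conj[OF lower[OF this(2)] upper[OF this(1)]]
  have "\<exists>n. k *\<^sub>R mat 1 \<preceq> Y 0 \<theta> n \<and> Y 0 \<theta> n \<preceq> K *\<^sub>R mat 1"
    by (rule eventually_happens'[OF sequentially_bot])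
  then have "k *\<^sub>R (mat 1 :: real ^ 'q ^ 'q) \<preceq> K *\<^sub>R mat 1"
    using loewner_trans by blast
  then show ?thesis
    by (simp only: loewner_mat_iff)
qed

text \<open>The ceiling speaks only of blocks with an end at \<open>\<theta>\<close>. Any other
  block before the break is compared with \<open>(0, \<theta>)\<close>, from which it differs by at
  most \<open>W\<close> in Frobenius norm, hence also as a quadratic form.\<close>

lemma upper_pre:
  assumes "(a, b) \<in> pre_blocks \<theta>"
  shows "\<forall>\<^sub>F n in sequentially. Y a b n \<preceq> (K + W) *\<^sub>R mat 1"
proof -
  have "(0, \<theta>) \<in> br_blocks \<theta>" "(0, \<theta>) \<in> pre_blocks \<theta>"
    using theta by (auto simp: br_blocks_def pre_blocks_def)
  from upper[OF this(1)] within[OF disjI1, OF conjI[OF assms this(2)]]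
  show ?thesis
  proof eventually_elim
    case (elim n)
    have "Y a b n = Y 0 \<theta> n + (Y a b n - Y 0 \<theta> n)" by simp
    also have "\<dots> \<preceq> K *\<^sub>R mat 1 + W *\<^sub>R mat 1"
      using elim loewner_trans[OF loewner_norm loewner_mat_mono] by (intro loewner_add) auto
    finally show ?case by (simp add: scaleR_add_left)
  qed
qed

lemma loewner_KW: "A \<preceq> K *\<^sub>R mat 1 \<Longrightarrow> A \<preceq> (K + W) *\<^sub>R mat 1"
  using loewner_trans[OF _ loewner_mat_mono[of K "K + W"]] W_nonneg by auto

lemma eventually_bd:
  shows "0 < \<nu> \<Longrightarrow> \<nu> \<le> \<theta> \<Longrightarrow> \<forall>\<^sub>F n in sequentially. bd 0 \<nu> n"
    and "0 \<le> \<nu> \<Longrightarrow> \<nu> < \<theta> \<Longrightarrow> \<forall>\<^sub>F n in sequentially. bd \<nu> \<theta> n"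
    and "\<forall>\<^sub>F n in sequentially. bd \<theta> 1 n"
proof -
  assume "0 < \<nu>" "\<nu> \<le> \<theta>"
  then have "(0, \<nu>) \<in> cut_blocks \<theta>" "(0, \<nu>) \<in> pre_blocks \<theta>" "\<forall>\<^sub>F n in sequentially. 0 < N 0 \<nu> n"
    using theta N_pos[of 0 \<nu>] by (auto simp: br_blocks_def cut_blocks_def pre_blocks_def)
  from this(3) lower[OF this(1)] upper_pre[OF this(2)]
  show "\<forall>\<^sub>F n in sequentially. bd 0 \<nu> n"
    unfolding bd_def by eventually_elim auto
next
  assume "0 \<le> \<nu>" "\<nu> < \<theta>"
  then have "(\<nu>, \<theta>) \<in> cut_blocks \<theta>" "(\<nu>, \<theta>) \<in> br_blocks \<theta>" "\<forall>\<^sub>F n in sequentially. 0 < N \<nu> \<theta> n"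
    using theta N_pos[of \<nu> \<theta>] by (auto simp: br_blocks_def cut_blocks_def)
  from this(3) lower[OF this(1)] upper[OF this(2)]
  show "\<forall>\<^sub>F n in sequentially. bd \<nu> \<theta> n"
    unfolding bd_def by eventually_elim (auto intro: loewner_KW)
next
  have "(\<theta>, 1) \<in> cut_blocks \<theta>" "(\<theta>, 1) \<in> br_blocks \<theta>" "\<forall>\<^sub>F n in sequentially. 0 < N \<theta> 1 n"
    using theta N_pos[of \<theta> 1] by (auto simp: br_blocks_def cut_blocks_def)
  from this(3) lower[OF this(1)] upper[OF this(2)]
  show "\<forall>\<^sub>F n in sequentially. bd \<theta> 1 n"
    unfolding bd_def by eventually_elim (auto intro: loewner_KW)
qed

text \<open>For \<open>\<nu> < \<theta>\<close> the block straddles the break and belongs to none of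
  the families; its bounds are inherited from its two pieces, of which it is a weighted
  mean.\<close>

lemma eventually_bd_right:
  assumes "0 \<le> \<nu>" "\<nu> \<le> \<theta>"
  shows "\<forall>\<^sub>F n in sequentially. bd \<nu> 1 n"
proof (cases "\<nu> = \<theta>")
  case False
  then have "\<nu> < \<theta>" using assms by simp
  from eventually_bd(2)[OF assms(1) this] eventually_bd(3)
  show ?thesis
  proof eventually_elim
    case (elim n)
    have pos: "0 < N \<nu> 1 n"
      using elim N_add[of \<nu> \<theta> 1 n] assms theta by (simp add: bd_def)
    with elim show ?case
      unfolding bd_def using merge_bounds[of \<nu> \<theta> 1 n] assms theta by simp
  qed
qed (use eventually_bd(3) in simp)

lemma eventually_obj_eq:
  assumes "0 < \<nu>" "\<nu> \<le> \<theta>"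
  shows "\<forall>\<^sub>F n in sequentially. obj n \<nu> = ereal (robj n \<nu>)"
  using eventually_bd(1)[OF assms] eventually_bd_right[OF less_imp_le[OF assms(1)] assms(2)]
  by eventually_elim (auto simp: bd_def intro!: obj_eq_robj[OF k_pos])

text \<open>The weights \<open>(\<theta> - \<nu>) (1 - \<theta>) / (1 - \<nu>)\<close> and
  \<open>\<nu> (\<theta> - \<nu>) / \<theta>\<close> are the limits of those in
  \<open>merge_gap\<close> for the merges at \<open>\<theta>\<close> and at \<open>\<nu>\<close>.
  Every \<open>r\<close> strictly below the limit is an eventual lower bound, which postpones
  extended reals.\<close>

theorem robj_increment:
  assumes \<nu>: "0 < \<nu>" "\<nu> < \<theta>"
    and r: "r < (\<theta> - \<nu>) / 2 * ((1 - \<theta>) / (1 - \<nu>) * (D\<^sup>2 / K\<^sup>2) - \<nu> / \<theta> * (W\<^sup>2 / k\<^sup>2))"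
  shows "\<forall>\<^sub>F n in sequentially. r < robj n \<nu> - robj n \<theta>"
proof -
  define \<alpha> \<beta> \<gamma> where "\<alpha> n = N 0 \<nu> n / n" and "\<beta> n = N \<nu> \<theta> n / n" and "\<gamma> n = N \<theta> 1 n / n" for n
  have lim: "\<alpha> \<longlonglongrightarrow> \<nu>" "\<beta> \<longlonglongrightarrow> \<theta> - \<nu>" "\<gamma> \<longlonglongrightarrow> 1 - \<theta>"
    using N_lim[of 0 \<nu>] N_lim[of \<nu> \<theta>] N_lim[of \<theta> 1] \<nu> theta by (simp_all add: \<alpha>_def[abs_def] \<beta>_def[abs_def] \<gamma>_def[abs_def])
  \<comment> \<open>The first two terms are the gap estimates with the actual block fractions; the
    bracket times \<open>LB\<close> pays for the difference between these fractions and the weights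
    in \<open>robj\<close>.\<close>
  define f where "f n = \<beta> n * \<gamma> n / (\<beta> n + \<gamma> n) * (D\<^sup>2 / (2 * K\<^sup>2)) - \<alpha> n * \<beta> n / (\<alpha> n + \<beta> n) * (W\<^sup>2 / (2 * k\<^sup>2))
    - (\<bar>\<nu> - \<alpha> n\<bar> + \<bar>1 - \<nu> - (\<beta> n + \<gamma> n)\<bar> + \<bar>\<theta> - (\<alpha> n + \<beta> n)\<bar> + \<bar>1 - \<theta> - \<gamma> n\<bar>) * LB" for n
  let ?l = "(\<theta> - \<nu>) * (1 - \<theta>) / ((\<theta> - \<nu>) + (1 - \<theta>)) * (D\<^sup>2 / (2 * K\<^sup>2)) - \<nu> * (\<theta> - \<nu>) / (\<nu> + (\<theta> - \<nu>)) * (W\<^sup>2 / (2 * k\<^sup>2))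
    - (\<bar>\<nu> - \<nu>\<bar> + \<bar>1 - \<nu> - ((\<theta> - \<nu>) + (1 - \<theta>))\<bar> + \<bar>\<theta> - (\<nu> + (\<theta> - \<nu>))\<bar> + \<bar>1 - \<theta> - (1 - \<theta>)\<bar>) * LB"
  have "f \<longlonglongrightarrow> ?l"
    unfolding f_def using \<nu> theta by (intro tendsto_intros lim) auto
  moreover have "?l = (\<theta> - \<nu>) / 2 * ((1 - \<theta>) / (1 - \<nu>) * (D\<^sup>2 / K\<^sup>2) - \<nu> / \<theta> * (W\<^sup>2 / k\<^sup>2))"
  proof -
    have *: "x * a / b * (c / (2 * d)) = x / 2 * (a / b * (c / d))" for x a b c d :: real
      by simp
    have "?l = (\<theta> - \<nu>) * (1 - \<theta>) / (1 - \<nu>) * (D\<^sup>2 / (2 * K\<^sup>2)) - (\<theta> - \<nu>) * \<nu> / \<theta> * (W\<^sup>2 / (2 * k\<^sup>2))"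
      by (simp add: mult.commute)
    then show ?thesis unfolding * by (simp only: right_diff_distrib)
  qed
  ultimately have rf: "\<forall>\<^sub>F n in sequentially. r < f n"
    using r by (metis order_tendstoD(1))
  have mem: "(\<nu>, \<theta>) \<in> br_blocks \<theta>" "(\<theta>, 1) \<in> br_blocks \<theta>" "(0, \<nu>) \<in> pre_blocks \<theta>" "(\<nu>, \<theta>) \<in> pre_blocks \<theta>"
      "(\<theta>, 1) \<in> post_blocks \<theta>"
    using \<nu> theta by (auto simp: br_blocks_def pre_blocks_def post_blocks_def)
  have "\<forall>\<^sub>F n in sequentially. bd 0 \<nu> n" "\<forall>\<^sub>F n in sequentially. bd \<nu> \<theta> n" "\<forall>\<^sub>F n in sequentially. bd \<theta> 1 n"
    "\<forall>\<^sub>F n in sequentially. bd 0 \<theta> n" "\<forall>\<^sub>F n in sequentially. bd \<nu> 1 n"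
    using \<nu> theta by (auto intro!: eventually_bd eventually_bd_right)
  from this upper[OF mem(1)] upper[OF mem(2)] within[OF disjI1, OF conjI[OF mem(3,4)]] between[OF mem(4,5)]
    rf eventually_gt_at_top[of 0]
  show ?thesis
  proof eventually_elim
    case (elim n)
    let ?A = "N 0 \<nu> n" and ?B = "N \<nu> \<theta> n" and ?C = "N \<theta> 1 n"
    have pos: "0 < ?A" "0 < ?B" "0 < ?C" "0 < N 0 \<theta> n" "0 < N \<nu> 1 n"
      using elim(1-5) by (auto simp: bd_def)
    have harm: "x / n * (y / n) / (x / n + y / n) = x * y / (x + y) / n" for x y :: real
      using elim(11) by (simp flip: add_divide_distrib)
    have add: "N 0 \<theta> n = ?A + ?B" "N \<nu> 1 n = ?B + ?C"
      using N_add[of 0 \<nu> \<theta> n] N_add[of \<nu> \<theta> 1 n] \<nu> theta by auto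
    \<comment> \<open>The upper estimate depends on the floor, so the coarse ceiling known for
      \<open>(0, \<nu>)\<close> costs nothing here.\<close>
    have "N 0 \<theta> n * ld 0 \<theta> n - ?A * ld 0 \<nu> n - ?B * ld \<nu> \<theta> n
      \<le> ?A * ?B / N 0 \<theta> n * (norm (Y 0 \<nu> n - Y \<nu> \<theta> n))\<^sup>2 / (2 * k\<^sup>2)"
      using elim(1,2) \<nu> pos by (intro merge_gap(2)[where K = "K + W"] k_pos) (use theta in \<open>auto simp: bd_def\<close>)
    also have "\<dots> \<le> ?A * ?B / N 0 \<theta> n * W\<^sup>2 / (2 * k\<^sup>2)"
      using elim(8) pos by (intro divide_right_mono mult_left_mono power_mono) auto
    finally have "N 0 \<theta> n * ld 0 \<theta> n - ?A * ld 0 \<nu> n - ?B * ld \<nu> \<theta> n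
      \<le> ?A * ?B / N 0 \<theta> n * W\<^sup>2 / (2 * k\<^sup>2)" .
    note e1 = divide_right_mono[OF this, of n]
    have 1: "(\<alpha> n + \<beta> n) * ld 0 \<theta> n - \<alpha> n * ld 0 \<nu> n - \<beta> n * ld \<nu> \<theta> n
      \<le> \<alpha> n * \<beta> n / (\<alpha> n + \<beta> n) * (W\<^sup>2 / (2 * k\<^sup>2))"
      using e1 unfolding \<alpha>_def \<beta>_def harm by (simp add: add diff_divide_distrib mult_ac flip: add_divide_distrib)
    \<comment> \<open>Both merged blocks have an end at the break, so the sharp ceiling
      \<open>K\<close> is available for the lower estimate.\<close>
    have "?B * ?C / N \<nu> 1 n * D\<^sup>2 / (2 * K\<^sup>2)
      \<le> ?B * ?C / N \<nu> 1 n * (norm (Y \<nu> \<theta> n - Y \<theta> 1 n))\<^sup>2 / (2 * K\<^sup>2)"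
      using elim(9) pos D_nonneg by (intro divide_right_mono mult_left_mono power_mono) auto
    also have "\<dots> \<le> N \<nu> 1 n * ld \<nu> 1 n - ?B * ld \<nu> \<theta> n - ?C * ld \<theta> 1 n"
      using elim(2,3,6,7) \<nu> pos by (intro merge_gap(1)[where k = k] k_pos) (use theta in \<open>auto simp: bd_def\<close>)
    finally have "?B * ?C / N \<nu> 1 n * D\<^sup>2 / (2 * K\<^sup>2)
      \<le> N \<nu> 1 n * ld \<nu> 1 n - ?B * ld \<nu> \<theta> n - ?C * ld \<theta> 1 n" .
    note e2 = divide_right_mono[OF this, of n]
    have 2: "\<beta> n * \<gamma> n / (\<beta> n + \<gamma> n) * (D\<^sup>2 / (2 * K\<^sup>2))
      \<le> (\<beta> n + \<gamma> n) * ld \<nu> 1 n - \<beta> n * ld \<nu> \<theta> n - \<gamma> n * ld \<theta> 1 n"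
      using e2 unfolding \<gamma>_def \<beta>_def harm by (simp add: add diff_divide_distrib mult_ac flip: add_divide_distrib)
    \<comment> \<open>The term with \<open>ld \<nu> \<theta> n\<close> is common to both gaps and
      cancels.\<close>
    have "robj n \<nu> - robj n \<theta> = ((\<beta> n + \<gamma> n) * ld \<nu> 1 n - \<beta> n * ld \<nu> \<theta> n - \<gamma> n * ld \<theta> 1 n)
      - ((\<alpha> n + \<beta> n) * ld 0 \<theta> n - \<alpha> n * ld 0 \<nu> n - \<beta> n * ld \<nu> \<theta> n)
      + (\<nu> - \<alpha> n) * ld 0 \<nu> n + (1 - \<nu> - (\<beta> n + \<gamma> n)) * ld \<nu> 1 n
      - (\<theta> - (\<alpha> n + \<beta> n)) * ld 0 \<theta> n - (1 - \<theta> - \<gamma> n) * ld \<theta> 1 n"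
      by (simp add: robj_def algebra_simps)
    then have "f n \<le> robj n \<nu> - robj n \<theta>"
      using 1 2 mult_abs_bounds(1)[OF bd_ld[OF elim(1)], of "\<nu> - \<alpha> n"]
        mult_abs_bounds(1)[OF bd_ld[OF elim(5)], of "1 - \<nu> - (\<beta> n + \<gamma> n)"]
        mult_abs_bounds(2)[OF bd_ld[OF elim(4)], of "\<theta> - (\<alpha> n + \<beta> n)"]
        mult_abs_bounds(2)[OF bd_ld[OF elim(3)], of "1 - \<theta> - \<gamma> n"]
      unfolding f_def distrib_right by linarith
    then show ?case using elim(10) by simp
  qed
qed

end

section \<open>Locally uniform comparison of cut points\<close>

context block_family
begin

text \<open>\<open>M\<close> stands in place of the exact size so that the factor can be chosen
  independently of a moving end point.\<close>

lemma Y_sub_block: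
  assumes "0 \<le> a" "a \<le> a'" "a' \<le> b'" "b' \<le> b" "b \<le> 1" "0 < N a b n" "N a b n \<le> M"
  shows "(N a' b' n / M) *\<^sub>R Y a' b' n \<preceq> Y a b n"
proof -
  have "N a' b' n *\<^sub>R Y a' b' n \<preceq> N a b n *\<^sub>R Y a b n"
    using assms by (intro Y_scale_mono)
  also have "\<dots> \<preceq> M *\<^sub>R Y a b n"
    using assms by (intro loewner_scaleR_right Y_psd)
  finally have "(1 / M) *\<^sub>R (N a' b' n *\<^sub>R Y a' b' n) \<preceq> (1 / M) *\<^sub>R (M *\<^sub>R Y a b n)"
    using assms by (intro loewner_scaleR) auto
  then show ?thesis using assms by simp
qed

text \<open>Here the shorter block dominates the longer one: the added piece is at most
  \<open>K *\<^sub>R mat 1\<close>, which is at most \<open>K / k\<close> times the moment of the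
  short block. The factor tends to 1 as the share of the added piece tends to 0.\<close>

lemma Y_extend_block:
  assumes "0 \<le> a" "a \<le> b" "b \<le> b'" "b' \<le> 1" "0 < N a b n"
    and k: "0 < k" "k *\<^sub>R mat 1 \<preceq> Y a b n" and K: "0 \<le> K" "Y b b' n \<preceq> K *\<^sub>R mat 1"
  shows "(N a b' n / (N a b n + N b b' n * (K / k))) *\<^sub>R Y a b' n \<preceq> Y a b n"
proof -
  let ?T = "N a b n + N b b' n * (K / k)"
  have T: "0 < ?T"
    using assms N_nonneg[of b b' n] by (intro add_pos_nonneg) auto
  have "K *\<^sub>R mat 1 = (K / k) *\<^sub>R (k *\<^sub>R (mat 1 :: real ^ 'q ^ 'q))"
    using k by simp
  also have "\<dots> \<preceq> (K / k) *\<^sub>R Y a b n"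
    using k K by (intro loewner_scaleR) auto
  finally have "Y b b' n \<preceq> (K / k) *\<^sub>R Y a b n"
    by (rule loewner_trans[OF K(2)])
  then have "N a b' n *\<^sub>R Y a b' n \<preceq> N a b n *\<^sub>R Y a b n + N b b' n *\<^sub>R ((K / k) *\<^sub>R Y a b n)"
    unfolding Y_add[OF assms(1-4)] by (intro loewner_add loewner_scaleR loewner_refl N_nonneg)
  also have "\<dots> = ?T *\<^sub>R Y a b n"
    by (simp add: scaleR_add_left)
  finally have "(1 / ?T) *\<^sub>R (N a b' n *\<^sub>R Y a b' n) \<preceq> (1 / ?T) *\<^sub>R (?T *\<^sub>R Y a b n)"
    using T by (intro loewner_scaleR) auto
  then show ?thesis using T by simp
qed

lemma obj_ge:
  assumes "0 \<le> \<nu>" "\<nu> \<le> 1" "ereal x \<le> log_ext (det (Y 0 \<nu> n))" "ereal z \<le> log_ext (det (Y \<nu> 1 n))"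
  shows "ereal (\<nu> * x + (1 - \<nu>) * z) \<le> obj n \<nu>"
proof -
  have "ereal \<nu> * ereal x + ereal (1 - \<nu>) * ereal z \<le> obj n \<nu>"
    unfolding obj_def using assms by (intro add_mono ereal_mult_left_mono) auto
  then show ?thesis by simp
qed

end

context contrast
begin

text \<open>\<open>(\<nu>, 1)\<close> contains \<open>(s', 1)\<close>, and \<open>(0, \<nu>)\<close>
  contains \<open>(0, s)\<close>, which dominates \<open>(0, s')\<close> up to a factor because the
  piece \<open>(s, s')\<close> lies in one regime. Spectral bounds are taken only at the fixed
  points \<open>s\<close> and \<open>s'\<close>, so the quantifier over \<open>\<nu>\<close> can
  stand inside the eventuality. The threshold for \<open>x\<close> collects the change of weights
  and the logarithms of the two factors.\<close>

lemma obj_transfer_interior: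
  assumes s: "0 < s" "s < s'" "s' < \<theta>"
    and x: "2 * LB * (s' - s) - CARD('q) * ln (s / (s + (s' - s) * ((K + W) / k)))
      - CARD('q) * ln ((1 - s') / (1 - s)) < x"
  shows "\<forall>\<^sub>F n in sequentially. \<forall>\<nu>\<in>{s<..<s'}. ereal (robj n s' - x) \<le> obj n \<nu>"
proof -
  define \<alpha> \<beta> where "\<alpha> n = N 0 s n / n" and "\<beta> n = N s s' n / n" for n
  define \<gamma> \<delta> where "\<gamma> n = N s' 1 n / n" and "\<delta> n = N s 1 n / n" for n
  define \<rho>1 \<rho>2 where "\<rho>1 n = \<alpha> n / (\<alpha> n + \<beta> n * ((K + W) / k))" and "\<rho>2 n = \<gamma> n / \<delta> n" for n
  define e where "e n = 2 * LB * (s' - s) - CARD('q) * ln (\<rho>1 n) - CARD('q) * ln (\<rho>2 n)" for n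
  have KW: "0 \<le> (K + W) / k"
    using k_pos k_le_K W_nonneg by simp
  have nz: "0 < s + (s' - s) * ((K + W) / k)"
    using s KW by (intro add_pos_nonneg mult_nonneg_nonneg) auto
  have lim: "\<alpha> \<longlonglongrightarrow> s" "\<beta> \<longlonglongrightarrow> s' - s" "\<gamma> \<longlonglongrightarrow> 1 - s'" "\<delta> \<longlonglongrightarrow> 1 - s"
    using N_lim[of 0 s] N_lim[of s s'] N_lim[of s' 1] N_lim[of s 1] s theta
    by (simp_all add: \<alpha>_def[abs_def] \<beta>_def[abs_def] \<gamma>_def[abs_def] \<delta>_def[abs_def])
  have "e \<longlonglongrightarrow> 2 * LB * (s' - s) - CARD('q) * ln (s / (s + (s' - s) * ((K + W) / k)))
      - CARD('q) * ln ((1 - s') / (1 - s))"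
    unfolding e_def \<rho>1_def \<rho>2_def using s theta nz by (intro tendsto_intros lim) auto
  then have ex: "\<forall>\<^sub>F n in sequentially. e n < x"
    using x by (rule order_tendstoD(2))
  have pre: "(s, s') \<in> pre_blocks \<theta>"
    using s by (simp add: pre_blocks_def)
  have "\<forall>\<^sub>F n in sequentially. bd 0 s n" "\<forall>\<^sub>F n in sequentially. bd 0 s' n" "\<forall>\<^sub>F n in sequentially. bd s' 1 n"
    "\<forall>\<^sub>F n in sequentially. bd s 1 n"
    using s by (auto intro!: eventually_bd eventually_bd_right)
  from this upper_pre[OF pre] ex eventually_gt_at_top[of 0]
  show ?thesis
  proof eventually_elim
    case (elim n)
    have pos: "0 < N 0 s n" "0 < N 0 s' n" "0 < N s' 1 n" "0 < N s 1 n"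
      using elim by (auto simp: bd_def)
    have \<rho>1: "\<rho>1 n = N 0 s n / (N 0 s n + N s s' n * ((K + W) / k))"
    proof -
      have "\<alpha> n + \<beta> n * t = (N 0 s n + N s s' n * t) / n" for t
        by (simp add: \<alpha>_def \<beta>_def add_divide_distrib)
      then show ?thesis unfolding \<rho>1_def using elim(7) by (simp only:) (simp add: \<alpha>_def)
    qed
    have \<rho>2: "\<rho>2 n = N s' 1 n / N s 1 n"
      using elim(7) by (simp add: \<rho>2_def \<gamma>_def \<delta>_def)
    have den: "0 < N 0 s n + N s s' n * ((K + W) / k)"
      using pos KW N_nonneg by (intro add_pos_nonneg mult_nonneg_nonneg)
    have r1: "0 < \<rho>1 n" "\<rho>1 n \<le> 1"
      using pos den mult_nonneg_nonneg[OF N_nonneg KW, of s s' n] unfolding \<rho>1 by auto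
    have r2: "0 < \<rho>2 n" "\<rho>2 n \<le> 1"
      using pos N_mono[of s s' 1 1 n] s theta unfolding \<rho>2 by auto
    \<comment> \<open>The logarithms of the factors are nonpositive, so replacing their weights
      \<open>\<nu>\<close> and \<open>1 - \<nu>\<close> by 1 only lowers the bound and removes its
      dependence on \<open>\<nu>\<close>.\<close>
    have shrink: "y \<le> t * y" if "y \<le> 0" "0 \<le> t" "t \<le> 1" for y t :: real
      using mult_right_mono_neg[of t 1 y] that by simp
    show ?case
    proof
      fix \<nu> assume \<nu>: "\<nu> \<in> {s<..<s'}"
      have "(N 0 s' n / (N 0 s n + N s s' n * ((K + W) / k))) *\<^sub>R Y 0 s' n \<preceq> Y 0 s n"
        using elim(1,5) s theta k_pos k_le_K W_nonneg pos by (intro Y_extend_block) (auto simp: bd_def)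
      then have "(N 0 s n / N 0 s' n) *\<^sub>R ((N 0 s' n / (N 0 s n + N s s' n * ((K + W) / k))) *\<^sub>R Y 0 s' n)
        \<preceq> (N 0 s n / N 0 s' n) *\<^sub>R Y 0 s n"
        using pos by (intro loewner_scaleR) auto
      also have "\<dots> \<preceq> Y 0 \<nu> n"
        using \<nu> s theta pos N_mono[of 0 0 s \<nu> n] N_mono[of 0 0 \<nu> s' n] by (intro Y_sub_block) auto
      finally have "\<rho>1 n *\<^sub>R Y 0 s' n \<preceq> Y 0 \<nu> n"
        using pos by (simp add: \<rho>1)
      then have 1: "ereal (ld 0 s' n + CARD('q) * ln (\<rho>1 n)) \<le> log_ext (det (Y 0 \<nu> n))"
        unfolding ld_def using elim(2) r1 by (intro log_ext_det_ge[OF Y_sym Y_sym k_pos]) (auto simp: bd_def)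
      have "\<rho>2 n *\<^sub>R Y s' 1 n \<preceq> Y \<nu> 1 n"
        unfolding \<rho>2 using \<nu> s theta pos N_mono[of \<nu> s' 1 1 n] N_mono[of s \<nu> 1 1 n] by (intro Y_sub_block) auto
      then have 2: "ereal (ld s' 1 n + CARD('q) * ln (\<rho>2 n)) \<le> log_ext (det (Y \<nu> 1 n))"
        unfolding ld_def using elim(3) r2 by (intro log_ext_det_ge[OF Y_sym Y_sym k_pos]) (auto simp: bd_def)
      let ?x = "ld 0 s' n + CARD('q) * ln (\<rho>1 n)" and ?z = "ld s' 1 n + CARD('q) * ln (\<rho>2 n)"
      have "\<nu> * ?x + (1 - \<nu>) * ?z = robj n s' + (\<nu> - s') * (ld 0 s' n - ld s' 1 n)
        + \<nu> * (CARD('q) * ln (\<rho>1 n)) + (1 - \<nu>) * (CARD('q) * ln (\<rho>2 n))"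
        by (simp add: robj_def algebra_simps)
      moreover have "CARD('q) * ln (\<rho>1 n) \<le> \<nu> * (CARD('q) * ln (\<rho>1 n))"
        "CARD('q) * ln (\<rho>2 n) \<le> (1 - \<nu>) * (CARD('q) * ln (\<rho>2 n))"
        using \<nu> s theta r1 r2 by (intro shrink; simp add: mult_le_0_iff)+
      moreover have "- (\<bar>\<nu> - s'\<bar> * (2 * LB)) \<le> (\<nu> - s') * (ld 0 s' n - ld s' 1 n)"
        using bd_ld[OF elim(2)] bd_ld[OF elim(3)] by (intro mult_abs_bounds) auto
      moreover have "\<bar>\<nu> - s'\<bar> * (2 * LB) \<le> (s' - s) * (2 * LB)"
        using \<nu> LB_nonneg by (intro mult_right_mono) auto
      ultimately have "robj n s' - x \<le> \<nu> * ?x + (1 - \<nu>) * ?z"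
        using elim(6) unfolding e_def by argo
      also have "ereal \<dots> \<le> obj n \<nu>"
        using \<nu> s theta 1 2 by (intro obj_ge) auto
      finally show "ereal (robj n s' - x) \<le> obj n \<nu>" by simp
    qed
  qed
qed

text \<open>Near 0 the block \<open>(0, \<nu>)\<close> may hold so few observations that no limit
  statement covers it. Its moment is bounded below by \<open>\<epsilon>\<close> alone, which
  suffices because its weight \<open>\<nu>\<close> is small.\<close>

lemma obj_transfer_boundary:
  assumes s: "0 < s" "s < \<theta>" and eps_pos: "0 < \<epsilon>"
    and x: "s * (\<bar>CARD('q) * ln \<epsilon>\<bar> + 2 * LB) - CARD('q) * ln (1 - s) < x"
  shows "\<forall>\<^sub>F n in sequentially. \<forall>\<nu>\<in>{0<..<s}. ereal (robj n s - x) \<le> obj n \<nu>"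
proof -
  define \<gamma> \<delta> where "\<gamma> n = N s 1 n / n" and "\<delta> n = N 0 1 n / n" for n
  define \<rho> where "\<rho> n = \<gamma> n / \<delta> n" for n
  define e where "e n = s * (\<bar>CARD('q) * ln \<epsilon>\<bar> + 2 * LB) - CARD('q) * ln (\<rho> n)" for n
  have lim: "\<gamma> \<longlonglongrightarrow> 1 - s" "\<delta> \<longlonglongrightarrow> 1 - 0"
    using N_lim[of s 1] N_lim[of 0 1] s theta
    by (simp_all add: \<gamma>_def[abs_def] \<delta>_def[abs_def])
  have "e \<longlonglongrightarrow> s * (\<bar>CARD('q) * ln \<epsilon>\<bar> + 2 * LB) - CARD('q) * ln ((1 - s) / (1 - 0))"
    unfolding e_def \<rho>_def using s theta by (intro tendsto_intros lim) auto
  then have ex: "\<forall>\<^sub>F n in sequentially. e n < x"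
    using x by (intro order_tendstoD(2)) auto
  have "\<forall>\<^sub>F n in sequentially. bd 0 s n" "\<forall>\<^sub>F n in sequentially. bd s 1 n" "\<forall>\<^sub>F n in sequentially. bd 0 1 n"
    using s theta by (auto intro!: eventually_bd eventually_bd_right)
  from this ex eventually_gt_at_top[of 0]
  show ?thesis
  proof eventually_elim
    case (elim n)
    have pos: "0 < N 0 s n" "0 < N s 1 n" "0 < N 0 1 n"
      using elim by (auto simp: bd_def)
    have \<rho>: "\<rho> n = N s 1 n / N 0 1 n"
      using elim(5) by (simp add: \<rho>_def \<gamma>_def \<delta>_def)
    have r: "0 < \<rho> n" "\<rho> n \<le> 1"
      using pos N_mono[of 0 s 1 1 n] s theta unfolding \<rho> by auto
    have shrink: "y \<le> t * y" if "y \<le> 0" "0 \<le> t" "t \<le> 1" for y t :: real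
      using mult_right_mono_neg[of t 1 y] that by simp
    show ?case
    proof
      fix \<nu> assume \<nu>: "\<nu> \<in> {0<..<s}"
      have "ereal (ln (det (\<epsilon> *\<^sub>R (mat 1 :: real ^ 'q ^ 'q))) + CARD('q) * ln 1) \<le> log_ext (det (Y 0 \<nu> n))"
        by (rule log_ext_det_ge[OF _ Y_sym eps_pos]) (simp_all add: Y_eps)
      then have 1: "ereal (CARD('q) * ln \<epsilon>) \<le> log_ext (det (Y 0 \<nu> n))"
        using eps_pos by (simp add: det_scaleR_mat ln_realpow)
      have "\<rho> n *\<^sub>R Y s 1 n \<preceq> Y \<nu> 1 n"
        unfolding \<rho> using \<nu> s theta pos N_mono[of \<nu> s 1 1 n] N_mono[of 0 \<nu> 1 1 n] by (intro Y_sub_block) auto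
      then have 2: "ereal (ld s 1 n + CARD('q) * ln (\<rho> n)) \<le> log_ext (det (Y \<nu> 1 n))"
        unfolding ld_def using elim(2) r by (intro log_ext_det_ge[OF Y_sym Y_sym k_pos]) (auto simp: bd_def)
      let ?x = "CARD('q) * ln \<epsilon>" and ?z = "ld s 1 n + CARD('q) * ln (\<rho> n)"
      have "\<nu> * ?x + (1 - \<nu>) * ?z = robj n s + \<nu> * ?x - s * ld 0 s n + (s - \<nu>) * ld s 1 n + (1 - \<nu>) * (CARD('q) * ln (\<rho> n))"
        by (simp add: robj_def algebra_simps)
      moreover have "CARD('q) * ln (\<rho> n) \<le> (1 - \<nu>) * (CARD('q) * ln (\<rho> n))"
        using \<nu> s theta r by (intro shrink; simp add: mult_le_0_iff)
      moreover have "- (\<bar>\<nu>\<bar> * \<bar>?x\<bar>) \<le> \<nu> * ?x" "s * ld 0 s n \<le> \<bar>s\<bar> * LB" "- (\<bar>s - \<nu>\<bar> * LB) \<le> (s - \<nu>) * ld s 1 n"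
        using bd_ld[OF elim(1)] bd_ld[OF elim(2)] by (intro mult_abs_bounds; simp)+
      moreover have "\<bar>\<nu>\<bar> * \<bar>?x\<bar> \<le> s * \<bar>?x\<bar>" "\<bar>s\<bar> * LB \<le> s * LB" "\<bar>s - \<nu>\<bar> * LB \<le> s * LB"
        using \<nu> LB_nonneg by (intro mult_right_mono; simp)+
      ultimately have "robj n s - x \<le> \<nu> * ?x + (1 - \<nu>) * ?z"
        using elim(4) by (simp add: e_def algebra_simps)
      also have "ereal \<dots> \<le> obj n \<nu>"
        using \<nu> s theta 1 2 by (intro obj_ge) auto
      finally show "ereal (robj n s - x) \<le> obj n \<nu>" by simp
    qed
  qed
qed

text \<open>On a window around \<open>l\<close> the objective is at least its value at the right end
  \<open>l + \<eta>\<close>, up to a loss that vanishes with \<open>\<eta>\<close>, while the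
  increment there is nearly \<open>c * (\<theta> - l)\<close> or more. A small enough
  \<open>\<eta>\<close> leaves a positive margin.\<close>

lemma separation_left:
  assumes c: "0 < c"
    and inc: "\<And>\<nu> r. 0 < \<nu> \<Longrightarrow> \<nu> < \<theta> \<Longrightarrow> r < c * (\<theta> - \<nu>) \<Longrightarrow> \<forall>\<^sub>F n in sequentially. r < robj n \<nu> - robj n \<theta>"
    and l: "0 \<le> l" "l < \<theta>" "\<epsilon> = 0 \<Longrightarrow> 0 < l"
  shows "\<exists>\<eta>>0. \<exists>\<kappa>>0. \<forall>\<^sub>F n in sequentially. \<forall>\<nu>\<in>{0<..<1}. \<bar>\<nu> - l\<bar> < \<eta> \<longrightarrow> ereal (robj n \<theta> + \<kappa>) \<le> obj n \<nu>"
proof -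
  \<comment> \<open>Half of the increment guaranteed at \<open>l\<close>; the other half absorbs the
    loss.\<close>
  define \<kappa> where "\<kappa> = c * (\<theta> - l) / 2"
  have \<kappa>: "0 < \<kappa>" "\<kappa> < c * (\<theta> - l)"
    using c l by (simp_all add: \<kappa>_def)
  \<comment> \<open>Reduces the interior case and the case \<open>l = 0\<close> to the choice of a
    window and of an admissible loss \<open>x\<close>.\<close>
  have *: ?thesis if \<eta>: "0 < \<eta>" "l + \<eta> < \<theta>" "\<kappa> + x < c * (\<theta> - (l + \<eta>))"
    and tr: "\<forall>\<^sub>F n in sequentially. \<forall>\<nu>\<in>{max 0 (l - \<eta>)<..<l + \<eta>}. ereal (robj n (l + \<eta>) - x) \<le> obj n \<nu>" for \<eta> x
  proof -
    have "\<forall>\<^sub>F n in sequentially. \<kappa> + x < robj n (l + \<eta>) - robj n \<theta>"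
      using \<eta> l by (intro inc) auto
    with tr have "\<forall>\<^sub>F n in sequentially. \<forall>\<nu>\<in>{0<..<1}. \<bar>\<nu> - l\<bar> < \<eta> \<longrightarrow> ereal (robj n \<theta> + \<kappa>) \<le> obj n \<nu>"
    proof eventually_elim
      case (elim n)
      show ?case
      proof (intro ballI impI)
        fix \<nu> assume "\<nu> \<in> {0<..<1}" "\<bar>\<nu> - l\<bar> < \<eta>"
        then have "\<nu> \<in> {max 0 (l - \<eta>)<..<l + \<eta>}" by auto
        with elim(1) have "ereal (robj n (l + \<eta>) - x) \<le> obj n \<nu>" by blast
        moreover have "ereal (robj n \<theta> + \<kappa>) \<le> ereal (robj n (l + \<eta>) - x)"
          using elim(2) by simp
        ultimately show "ereal (robj n \<theta> + \<kappa>) \<le> obj n \<nu>" by (rule order_trans[rotated])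
      qed
    qed
    then show ?thesis using \<eta>(1) \<kappa>(1) by blast
  qed
  \<comment> \<open>Used with \<open>B\<close> the increment and \<open>C\<close> the loss: the
    midpoint choice of \<open>x\<close> lies strictly above the loss and still leaves more than
    \<open>\<kappa>\<close>.\<close>
  have half: "C < B - (\<kappa> + (B - C)) / 2" if "\<kappa> < B - C" for B C
    using that by argo
  show ?thesis
  proof (cases "l = 0")
    case False
    then have l0: "0 < l" using l by simp
    define E where "E \<eta> = c * (\<theta> - (l + \<eta>)) - (2 * LB * ((l + \<eta>) - (l - \<eta>))
      - CARD('q) * ln ((l - \<eta>) / ((l - \<eta>) + ((l + \<eta>) - (l - \<eta>)) * ((K + W) / k)))
      - CARD('q) * ln ((1 - (l + \<eta>)) / (1 - (l - \<eta>))))" for \<eta>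
    have "(E \<longlongrightarrow> c * (\<theta> - (l + 0)) - (2 * LB * ((l + 0) - (l - 0))
      - CARD('q) * ln ((l - 0) / ((l - 0) + ((l + 0) - (l - 0)) * ((K + W) / k)))
      - CARD('q) * ln ((1 - (l + 0)) / (1 - (l - 0))))) (at_right 0)"
      unfolding E_def using l0 l theta k_pos by (intro tendsto_intros) auto
    then have "(E \<longlongrightarrow> c * (\<theta> - l)) (at_right 0)"
      using l0 l theta by simp
    then have "\<forall>\<^sub>F \<eta> in at_right 0. \<kappa> < E \<eta>"
      using \<kappa>(2) by (rule order_tendstoD(1))
    moreover have "\<forall>\<^sub>F \<eta> in at_right 0. \<eta> \<in> {0<..<min l (\<theta> - l)}"
      using l l0 by (intro eventually_at_right_real) auto
    ultimately have "\<forall>\<^sub>F \<eta> in at_right 0. \<kappa> < E \<eta> \<and> \<eta> \<in> {0<..<min l (\<theta> - l)}"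
      by (rule eventually_conj)
    then obtain \<eta> where \<eta>: "\<kappa> < E \<eta>" "0 < \<eta>" "\<eta> < l" "\<eta> < \<theta> - l"
      using eventually_happens'[OF trivial_limit_at_right_real] by force
    let ?x = "c * (\<theta> - (l + \<eta>)) - (\<kappa> + E \<eta>) / 2"
    have "\<forall>\<^sub>F n in sequentially. \<forall>\<nu>\<in>{l - \<eta><..<l + \<eta>}. ereal (robj n (l + \<eta>) - ?x) \<le> obj n \<nu>"
      using \<eta> half[OF \<eta>(1)[unfolded E_def]] unfolding E_def by (intro obj_transfer_interior) auto
    then show ?thesis
      using \<eta> by (intro *[of \<eta> ?x]) auto
  next
    case True
    then have eps_pos: "0 < \<epsilon>" using l eps by force
    define E where "E \<eta> = c * (\<theta> - \<eta>) - (\<eta> * (\<bar>CARD('q) * ln \<epsilon>\<bar> + 2 * LB) - CARD('q) * ln (1 - \<eta>))" for \<eta>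
    have "(E \<longlongrightarrow> c * (\<theta> - 0) - (0 * (\<bar>CARD('q) * ln \<epsilon>\<bar> + 2 * LB) - CARD('q) * ln (1 - 0))) (at_right 0)"
      unfolding E_def by (intro tendsto_intros) auto
    then have "(E \<longlongrightarrow> c * (\<theta> - l)) (at_right 0)"
      using True by simp
    then have "\<forall>\<^sub>F \<eta> in at_right 0. \<kappa> < E \<eta>"
      using \<kappa>(2) by (rule order_tendstoD(1))
    moreover have "\<forall>\<^sub>F \<eta> in at_right 0. \<eta> \<in> {0<..<\<theta>}"
      using theta by (intro eventually_at_right_real) auto
    ultimately have "\<forall>\<^sub>F \<eta> in at_right 0. \<kappa> < E \<eta> \<and> \<eta> \<in> {0<..<\<theta>}"
      by (rule eventually_conj)
    then obtain \<eta> where \<eta>: "\<kappa> < E \<eta>" "0 < \<eta>" "\<eta> < \<theta>"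
      using eventually_happens'[OF trivial_limit_at_right_real] by force
    let ?x = "c * (\<theta> - \<eta>) - (\<kappa> + E \<eta>) / 2"
    have "\<forall>\<^sub>F n in sequentially. \<forall>\<nu>\<in>{0<..<\<eta>}. ereal (robj n \<eta> - ?x) \<le> obj n \<nu>"
      using \<eta> eps_pos half[OF \<eta>(1)[unfolded E_def]] unfolding E_def by (intro obj_transfer_boundary) auto
    then show ?thesis
      using \<eta> True by (intro *[of \<eta> ?x]) auto
  qed
qed

end

section \<open>The sign of the increment factor\<close>

lemma increment_factor_local:
  fixes \<theta> \<nu> u v :: real
  assumes "0 < \<theta>" "\<theta> < 1" "0 \<le> v" "v < u" "0 < \<nu>" "\<nu> < \<theta>" "\<theta> - \<nu> < (1 - \<theta>) * (u - v) / (2 * u)"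
  shows "(u - v) / 2 \<le> (1 - \<theta>) / (1 - \<nu>) * u - \<nu> / \<theta> * v"
proof -
  have "(\<theta> - \<nu>) / (1 - \<nu>) \<le> (\<theta> - \<nu>) / (1 - \<theta>)"
    using assms by (intro divide_left_mono) auto
  also have "\<dots> \<le> (u - v) / (2 * u)"
    using assms by (simp add: field_simps)
  \<comment> \<open>The admissible distance is chosen so that the first weight stays above this
    value; times \<open>u\<close> it is the midpoint of \<open>u\<close> and \<open>v\<close>, while
    the second weight is below 1.\<close>
  finally have "1 - (u - v) / (2 * u) \<le> (1 - \<theta>) / (1 - \<nu>)"
    using assms by (simp add: field_simps)
  then have "(1 - (u - v) / (2 * u)) * u \<le> (1 - \<theta>) / (1 - \<nu>) * u"
    using assms by (intro mult_right_mono) auto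
  moreover have "(1 - (u - v) / (2 * u)) * u = (u + v) / 2"
    using assms by (simp add: field_simps)
  moreover have "\<nu> / \<theta> * v \<le> 1 * v"
    using assms by (intro mult_right_mono) auto
  ultimately show ?thesis by argo
qed

text \<open>Taking out \<open>(1 - \<theta>) / (1 - \<nu>)\<close> leaves
  \<open>u - \<nu> (1 - \<nu>) v / (\<theta> (1 - \<theta>))\<close>, and
  \<open>\<nu> (1 - \<nu>)\<close> is at most 1/4.\<close>

lemma increment_factor_global:
  fixes \<theta> \<nu> u v :: real
  assumes "0 < \<theta>" "\<theta> < 1" "0 \<le> v" "v < 4 * (\<theta> * (1 - \<theta>)) * u" "0 < \<nu>" "\<nu> < \<theta>"
  shows "(1 - \<theta>) * (u - v / (4 * (\<theta> * (1 - \<theta>)))) \<le> (1 - \<theta>) / (1 - \<nu>) * u - \<nu> / \<theta> * v"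
proof -
  let ?t = "\<theta> * (1 - \<theta>)"
  have t: "0 < ?t" using assms by simp
  have "0 \<le> (\<nu> - 1 / 2)\<^sup>2" by simp
  then have "\<nu> * (1 - \<nu>) \<le> 1 / 4" by (simp add: power2_eq_square algebra_simps)
  then have "\<nu> * (1 - \<nu>) * (v / ?t) \<le> 1 / 4 * (v / ?t)"
    using t assms by (intro mult_right_mono) auto
  then have le: "u - v / (4 * ?t) \<le> u - \<nu> * (1 - \<nu>) * (v / ?t)" by simp
  have pos: "0 \<le> u - v / (4 * ?t)"
    using assms t by (simp add: field_simps)
  have "1 - \<theta> \<le> (1 - \<theta>) / (1 - \<nu>)"
    using assms by (simp add: field_simps)
  then have "(1 - \<theta>) * (u - v / (4 * ?t)) \<le> (1 - \<theta>) / (1 - \<nu>) * (u - \<nu> * (1 - \<nu>) * (v / ?t))"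
    using le pos assms by (intro mult_mono) auto
  also have "\<dots> = (1 - \<theta>) / (1 - \<nu>) * u - \<nu> / \<theta> * v"
  proof -
    have "a / b * (n * b * (x / (t * a))) = n / t * x" if "a \<noteq> 0" "b \<noteq> 0" for a b n t x :: real
      using that by simp
    then have "(1 - \<theta>) / (1 - \<nu>) * (\<nu> * (1 - \<nu>) * (v / ?t)) = \<nu> / \<theta> * v"
      using assms by (metis diff_gt_0_iff_gt less_irrefl less_trans)
    then show ?thesis by (simp only: right_diff_distrib[of "(1 - \<theta>) / (1 - \<nu>)"])
  qed
  finally show ?thesis .
qed

context contrast
begin

lemma increment_left_local:
  assumes "W\<^sup>2 / k\<^sup>2 < D\<^sup>2 / K\<^sup>2"
  shows "\<exists>\<delta>>0. \<exists>c>0. \<forall>\<nu> r. 0 < \<nu> \<and> \<theta> - \<delta> < \<nu> \<and> \<nu> < \<theta> \<and> r < c * (\<theta> - \<nu>) \<longrightarrow>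
    (\<forall>\<^sub>F n in sequentially. r < robj n \<nu> - robj n \<theta>)"
proof -
  let ?u = "D\<^sup>2 / K\<^sup>2" and ?v = "W\<^sup>2 / k\<^sup>2"
  have v: "0 \<le> ?v" by simp
  \<comment> \<open>The quarter in \<open>?c\<close> is the product of the prefactor 1/2 of the
    increment and the 1/2 in the bound of the factor.\<close>
  let ?\<delta> = "(1 - \<theta>) * (?u - ?v) / (2 * ?u)" and ?c = "(?u - ?v) / 4"
  have "\<forall>\<^sub>F n in sequentially. r < robj n \<nu> - robj n \<theta>"
    if "0 < \<nu>" "\<theta> - ?\<delta> < \<nu>" "\<nu> < \<theta>" "r < ?c * (\<theta> - \<nu>)" for \<nu> r
  proof (rule robj_increment[OF that(1,3)])
    have "(?u - ?v) / 2 \<le> (1 - \<theta>) / (1 - \<nu>) * ?u - \<nu> / \<theta> * ?v"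
      using that by (intro increment_factor_local[OF theta v assms]) linarith+
    then have "(\<theta> - \<nu>) / 2 * ((?u - ?v) / 2) \<le> (\<theta> - \<nu>) / 2 * ((1 - \<theta>) / (1 - \<nu>) * ?u - \<nu> / \<theta> * ?v)"
      using that by (intro mult_left_mono) auto
    moreover have "?c * (\<theta> - \<nu>) = (\<theta> - \<nu>) / 2 * ((?u - ?v) / 2)"
      by simp
    ultimately show "r < (\<theta> - \<nu>) / 2 * ((1 - \<theta>) / (1 - \<nu>) * ?u - \<nu> / \<theta> * ?v)"
      using that(4) by linarith
  qed
  moreover have "0 < ?\<delta>"
  proof -
    have "0 < (1 - \<theta>) * (u - v) / (2 * u)" if "v < u" "0 \<le> v" for u v :: real
      using that theta by simp
    from this[OF assms v] show ?thesis .
  qed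
  moreover have "0 < ?c"
    using assms by simp
  ultimately show ?thesis by blast
qed

lemma increment_left_global:
  assumes "W\<^sup>2 / k\<^sup>2 < 4 * (\<theta> * (1 - \<theta>)) * (D\<^sup>2 / K\<^sup>2)"
  shows "\<exists>c>0. \<forall>\<nu> r. 0 < \<nu> \<and> \<nu> < \<theta> \<and> r < c * (\<theta> - \<nu>) \<longrightarrow>
    (\<forall>\<^sub>F n in sequentially. r < robj n \<nu> - robj n \<theta>)"
proof -
  let ?u = "D\<^sup>2 / K\<^sup>2" and ?v = "W\<^sup>2 / k\<^sup>2"
  have v: "0 \<le> ?v" by simp
  let ?g = "(1 - \<theta>) * (?u - ?v / (4 * (\<theta> * (1 - \<theta>))))"
  have "\<forall>\<^sub>F n in sequentially. r < robj n \<nu> - robj n \<theta>"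
    if "0 < \<nu>" "\<nu> < \<theta>" "r < ?g / 2 * (\<theta> - \<nu>)" for \<nu> r
  proof (rule robj_increment[OF that(1,2)])
    have "?g \<le> (1 - \<theta>) / (1 - \<nu>) * ?u - \<nu> / \<theta> * ?v"
      using that by (intro increment_factor_global[OF theta v assms])
    then have "(\<theta> - \<nu>) / 2 * ?g \<le> (\<theta> - \<nu>) / 2 * ((1 - \<theta>) / (1 - \<nu>) * ?u - \<nu> / \<theta> * ?v)"
      using that by (intro mult_left_mono) auto
    moreover have "?g / 2 * (\<theta> - \<nu>) = (\<theta> - \<nu>) / 2 * ?g"
      by simp
    ultimately show "r < (\<theta> - \<nu>) / 2 * ((1 - \<theta>) / (1 - \<nu>) * ?u - \<nu> / \<theta> * ?v)"
      using that(3) by linarith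
  qed
  moreover have "0 < ?g / 2"
  proof -
    have "x / y < z" if "0 < y" "x < y * z" for x y z :: real
      using that by (simp add: pos_divide_less_eq mult.commute)
    from this[OF _ assms] have "?v / (4 * (\<theta> * (1 - \<theta>))) < ?u"
      using theta by simp
    then show ?thesis using theta by simp
  qed
  ultimately show ?thesis by blast
qed

section \<open>Time reversal and cut points after the break\<close>

lemma reflect_contrast:
  "contrast (\<lambda>a b. N (1 - b) (1 - a)) (\<lambda>a b. S (1 - b) (1 - a)) \<epsilon> (1 - \<theta>) k K W D"
proof -
  interpret R: block_family "\<lambda>a b. N (1 - b) (1 - a)" "\<lambda>a b. S (1 - b) (1 - a)" \<epsilon>
    by (rule reflect)
  have Y: "R.Y a b n = Y (1 - b) (1 - a) n" for a b n
    by (simp add: R.Y_def Y_def)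
  have sets: "(a, b) \<in> cut_blocks (1 - \<theta>) \<Longrightarrow> (1 - b, 1 - a) \<in> cut_blocks \<theta>"
    "(a, b) \<in> br_blocks (1 - \<theta>) \<Longrightarrow> (1 - b, 1 - a) \<in> br_blocks \<theta>"
    "(a, b) \<in> pre_blocks (1 - \<theta>) \<Longrightarrow> (1 - b, 1 - a) \<in> post_blocks \<theta>"
    "(a, b) \<in> post_blocks (1 - \<theta>) \<Longrightarrow> (1 - b, 1 - a) \<in> pre_blocks \<theta>" for a b
    using theta by (auto simp: cut_blocks_def br_blocks_def pre_blocks_def post_blocks_def)
  show ?thesis
  proof
    show "\<forall>\<^sub>F n in sequentially. norm (R.Y a b n - R.Y c d n) \<le> W"
      if "(a, b) \<in> pre_blocks (1 - \<theta>) \<and> (c, d) \<in> pre_blocks (1 - \<theta>)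
        \<or> (a, b) \<in> post_blocks (1 - \<theta>) \<and> (c, d) \<in> post_blocks (1 - \<theta>)" for a b c d
      using that sets unfolding Y by (intro within) blast
    show "\<forall>\<^sub>F n in sequentially. D \<le> norm (R.Y a b n - R.Y c d n)"
      if "(a, b) \<in> pre_blocks (1 - \<theta>)" "(c, d) \<in> post_blocks (1 - \<theta>)" for a b c d
      using between[OF sets(4)[OF that(2)] sets(3)[OF that(1)]] unfolding Y by (simp add: norm_minus_commute)
  qed (use theta k_pos W_nonneg D_nonneg lower upper sets in \<open>auto simp: Y\<close>)
qed

text \<open>
  The reversed family is a contrast family for \<open>1 - \<theta>\<close>, which turns the statements about
  \<open>\<nu> < \<theta>\<close> into statements about \<open>\<nu> > \<theta>\<close>.
\<close>

interpretation R: contrast "\<lambda>a b. N (1 - b) (1 - a)" "\<lambda>a b. S (1 - b) (1 - a)" \<epsilon> "1 - \<theta>" k K W D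
  by (rule reflect_contrast)

lemma reflected_obj: "R.obj n \<nu> = obj n (1 - \<nu>)"
  and reflected_robj: "R.robj n \<nu> = robj n (1 - \<nu>)"
  by (simp_all add: R.obj_def R.robj_def obj_def robj_def R.Y_def Y_def R.ld_def ld_def add.commute)

lemma eventually_obj_eq_robj:
  assumes "0 < \<nu>" "\<nu> < 1"
  shows "\<forall>\<^sub>F n in sequentially. obj n \<nu> = ereal (robj n \<nu>)"
  using eventually_obj_eq[of \<nu>] R.eventually_obj_eq[of "1 - \<nu>"] assms
  by (cases "\<nu> \<le> \<theta>") (auto simp: reflected_obj reflected_robj)

lemma increment_local:
  assumes "W\<^sup>2 / k\<^sup>2 < D\<^sup>2 / K\<^sup>2"
  shows "\<exists>\<delta> c. 0 < \<delta> \<and> 0 < c \<and> (\<forall>\<nu>\<in>{\<theta> - \<delta><..<\<theta> + \<delta>} \<inter> {0<..<1}. \<forall>r < c * \<bar>\<nu> - \<theta>\<bar>.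
    \<forall>\<^sub>F n in sequentially. r < robj n \<nu> - robj n \<theta>)"
proof -
  obtain \<delta>1 c1 where left: "0 < \<delta>1" "0 < c1" "\<And>\<nu> r. 0 < \<nu> \<and> \<theta> - \<delta>1 < \<nu> \<and> \<nu> < \<theta> \<and> r < c1 * (\<theta> - \<nu>) \<Longrightarrow>
    (\<forall>\<^sub>F n in sequentially. r < robj n \<nu> - robj n \<theta>)"
    using increment_left_local[OF assms] by blast
  obtain \<delta>2 c2 where right: "0 < \<delta>2" "0 < c2" "\<And>\<nu> r. 0 < \<nu> \<and> 1 - \<theta> - \<delta>2 < \<nu> \<and> \<nu> < 1 - \<theta> \<and> r < c2 * (1 - \<theta> - \<nu>) \<Longrightarrow>
    (\<forall>\<^sub>F n in sequentially. r < robj n (1 - \<nu>) - robj n \<theta>)"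
    using R.increment_left_local[OF assms] by (auto simp: reflected_robj)
  show ?thesis
  proof (intro exI conjI ballI allI impI)
    show "0 < min \<delta>1 \<delta>2" "0 < min c1 c2" using left right by auto
    fix \<nu> r assume \<nu>: "\<nu> \<in> {\<theta> - min \<delta>1 \<delta>2<..<\<theta> + min \<delta>1 \<delta>2} \<inter> {0<..<1}"
      and r: "r < min c1 c2 * \<bar>\<nu> - \<theta>\<bar>"
    have "min c1 c2 * \<bar>\<nu> - \<theta>\<bar> \<le> c1 * \<bar>\<nu> - \<theta>\<bar>" "min c1 c2 * \<bar>\<nu> - \<theta>\<bar> \<le> c2 * \<bar>\<nu> - \<theta>\<bar>"
      by (intro mult_right_mono; simp)+
    with r have r': "r < c1 * \<bar>\<nu> - \<theta>\<bar>" "r < c2 * \<bar>\<nu> - \<theta>\<bar>" by linarith+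
    consider "\<nu> < \<theta>" | "\<nu> = \<theta>" | "\<theta> < \<nu>" by linarith
    then show "\<forall>\<^sub>F n in sequentially. r < robj n \<nu> - robj n \<theta>"
    proof cases
      case 1
      then show ?thesis using \<nu> r' by (intro left(3)) auto
    next
      case 3
      then show ?thesis using \<nu> r' right(3)[of "1 - \<nu>" r] by (auto simp: algebra_simps)
    qed (use r in simp)
  qed
qed

lemma increment_global:
  assumes "W\<^sup>2 / k\<^sup>2 < 4 * (\<theta> * (1 - \<theta>)) * (D\<^sup>2 / K\<^sup>2)"
  shows "\<exists>c>0. \<forall>\<nu>\<in>{0<..<1}. \<forall>r < c * \<bar>\<nu> - \<theta>\<bar>. \<forall>\<^sub>F n in sequentially. r < robj n \<nu> - robj n \<theta>"
proof -
  obtain c1 where left: "0 < c1" "\<And>\<nu> r. 0 < \<nu> \<and> \<nu> < \<theta> \<and> r < c1 * (\<theta> - \<nu>) \<Longrightarrow>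
    (\<forall>\<^sub>F n in sequentially. r < robj n \<nu> - robj n \<theta>)"
    using increment_left_global[OF assms] by blast
  obtain c2 where right: "0 < c2" "\<And>\<nu> r. 0 < \<nu> \<and> \<nu> < 1 - \<theta> \<and> r < c2 * (1 - \<theta> - \<nu>) \<Longrightarrow>
    (\<forall>\<^sub>F n in sequentially. r < robj n (1 - \<nu>) - robj n \<theta>)"
    using R.increment_left_global assms by (auto simp: reflected_robj mult.commute)
  show ?thesis
  proof (intro exI conjI ballI allI impI)
    show "0 < min c1 c2" using left right by auto
    fix \<nu> r assume \<nu>: "\<nu> \<in> {0<..<1}"
      and r: "r < min c1 c2 * \<bar>\<nu> - \<theta>\<bar>"
    have "min c1 c2 * \<bar>\<nu> - \<theta>\<bar> \<le> c1 * \<bar>\<nu> - \<theta>\<bar>" "min c1 c2 * \<bar>\<nu> - \<theta>\<bar> \<le> c2 * \<bar>\<nu> - \<theta>\<bar>"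
      by (intro mult_right_mono; simp)+
    with r have r': "r < c1 * \<bar>\<nu> - \<theta>\<bar>" "r < c2 * \<bar>\<nu> - \<theta>\<bar>" by linarith+
    consider "\<nu> < \<theta>" | "\<nu> = \<theta>" | "\<theta> < \<nu>" by linarith
    then show "\<forall>\<^sub>F n in sequentially. r < robj n \<nu> - robj n \<theta>"
    proof cases
      case 3
      then show ?thesis using \<nu> r' right(2)[of "1 - \<nu>" r] by (auto simp: algebra_simps)
    qed (use \<nu> r r' in \<open>auto intro!: left(2)\<close>)
  qed
qed

section \<open>From increments to limits inferior and minimizers\<close>

lemma liminf_obj:
  assumes \<nu>: "0 < \<nu>" "\<nu> < 1" and inc: "\<forall>r<l. \<forall>\<^sub>F n in sequentially. r < robj n \<nu> - robj n \<theta>"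
  shows "ereal l \<le> liminf (\<lambda>n. obj n \<nu> - obj n \<theta>)"
  unfolding le_Liminf_iff
proof (intro allI impI)
  fix x assume "x < ereal l"
  then obtain r where r: "x < ereal r" "r < l"
    using ereal_dense2[of x "ereal l"] by auto
  \<comment> \<open>Both values are eventually finite, so the difference of extended reals is an
    ordinary difference.\<close>
  from eventually_obj_eq_robj[OF \<nu>] eventually_obj_eq_robj[OF theta] inc[rule_format, OF r(2)]
  show "\<forall>\<^sub>F n in sequentially. x < obj n \<nu> - obj n \<theta>"
  proof eventually_elim
    case (elim n)
    then show ?case using r(1) less_trans[of x "ereal r"] by simp
  qed
qed

lemma separation:
  assumes c: "0 < c"
    and inc: "\<And>\<nu> r. 0 < \<nu> \<Longrightarrow> \<nu> < 1 \<Longrightarrow> r < c * \<bar>\<nu> - \<theta>\<bar> \<Longrightarrow> \<forall>\<^sub>F n in sequentially. r < robj n \<nu> - robj n \<theta>"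
    and l: "0 \<le> l" "l \<le> 1" "l \<noteq> \<theta>" "\<epsilon> = 0 \<Longrightarrow> 0 < l \<and> l < 1"
  shows "\<exists>\<eta>>0. \<exists>\<kappa>>0. \<forall>\<^sub>F n in sequentially. \<forall>\<nu>\<in>{0<..<1}. \<bar>\<nu> - l\<bar> < \<eta> \<longrightarrow> ereal (robj n \<theta> + \<kappa>) \<le> obj n \<nu>"
proof (cases "l < \<theta>")
  case True
  have "\<forall>\<^sub>F n in sequentially. r < robj n \<nu> - robj n \<theta>" if "0 < \<nu>" "\<nu> < \<theta>" "r < c * (\<theta> - \<nu>)" for \<nu> r
    using inc[of \<nu> r] that theta by simp
  with True show ?thesis using separation_left[OF c] l by blast
next
  case False
  have "\<forall>\<^sub>F n in sequentially. r < R.robj n \<nu> - R.robj n (1 - \<theta>)" if "0 < \<nu>" "\<nu> < 1 - \<theta>" "r < c * (1 - \<theta> - \<nu>)" for \<nu> r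
  proof -
    have "\<bar>1 - \<nu> - \<theta>\<bar> = 1 - \<theta> - \<nu>" using that by simp
    then have "r < c * \<bar>1 - \<nu> - \<theta>\<bar>" using that(3) by (simp only:)
    then show ?thesis using inc[of "1 - \<nu>" r] that theta by (simp add: reflected_robj)
  qed
  then obtain \<eta> \<kappa> where \<eta>: "0 < \<eta>" "0 < \<kappa>" and ev: "\<forall>\<^sub>F n in sequentially. \<forall>\<nu>\<in>{0<..<1}. \<bar>\<nu> - (1 - l)\<bar> < \<eta> \<longrightarrow> ereal (robj n \<theta> + \<kappa>) \<le> obj n (1 - \<nu>)"
    using R.separation_left[OF c, of "1 - l"] False l unfolding reflected_robj reflected_obj by auto
  from ev have "\<forall>\<^sub>F n in sequentially. \<forall>\<nu>\<in>{0<..<1}. \<bar>\<nu> - l\<bar> < \<eta> \<longrightarrow> ereal (robj n \<theta> + \<kappa>) \<le> obj n \<nu>"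
  proof eventually_elim
    case (elim n)
    show ?case
    proof (intro ballI impI)
      fix \<nu> assume "\<nu> \<in> {0<..<1}" "\<bar>\<nu> - l\<bar> < \<eta>"
      then show "ereal (robj n \<theta> + \<kappa>) \<le> obj n \<nu>"
        using elim[rule_format, of "1 - \<nu>"] by (simp add: abs_minus_commute)
    qed
  qed
  with \<eta> show ?thesis by blast
qed

text \<open>
  The break fraction itself need not lie on the grid, so minimizers are compared with points
  \<open>g n\<close> that cut the series in the same place.
\<close>

lemma minimizers_converge:
  assumes c: "0 < c"
    and inc: "\<And>\<nu> r. 0 < \<nu> \<Longrightarrow> \<nu> < 1 \<Longrightarrow> r < c * \<bar>\<nu> - \<theta>\<bar> \<Longrightarrow> \<forall>\<^sub>F n in sequentially. r < robj n \<nu> - robj n \<theta>"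
    and I: "closed I" "I \<subseteq> {0..1}" "\<epsilon> = 0 \<Longrightarrow> I \<subseteq> {0<..<1}"
    and h: "\<forall>\<^sub>F n in sequentially. h n \<in> I \<inter> {0<..<1} \<and> obj n (h n) \<le> obj n (g n)"
    and g: "g \<longlonglongrightarrow> \<theta>" "\<forall>\<^sub>F n in sequentially. Y 0 (g n) n = Y 0 \<theta> n \<and> Y (g n) 1 n = Y \<theta> 1 n"
  shows "h \<longlonglongrightarrow> \<theta>"
proof (rule ccontr)
  assume "\<not> h \<longlonglongrightarrow> \<theta>"
  then obtain e where e: "0 < e" "\<not> (\<forall>\<^sub>F n in sequentially. dist (h n) \<theta> < e)"
    by (auto simp: tendsto_iff)
  let ?P = "\<lambda>n. \<not> dist (h n) \<theta> < e \<and> h n \<in> I \<inter> {0<..<1} \<and> obj n (h n) \<le> obj n (g n)"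
  have "\<exists>\<^sub>F n in sequentially. ?P n"
    using frequently_eventually_frequently[OF e(2)[unfolded not_eventually] h] .
  then have "infinite {n. ?P n}"
    unfolding cofinite_eq_sequentially[symmetric] frequently_cofinite .
  \<comment> \<open>A subsequence keeps its distance from \<open>\<theta>\<close>, and compactness
    of \<open>I\<close> provides a cluster point \<open>l\<close>, near which
    \<open>separation\<close> rules out minimizers. For \<open>\<epsilon> = 0\<close> the choice of
    \<open>I\<close> keeps \<open>l\<close> away from 0 and 1.\<close>
  then obtain \<sigma> :: "nat \<Rightarrow> nat" where \<sigma>: "strict_mono \<sigma>" "\<And>n. ?P (\<sigma> n)"
    using infinite_enumerate[of "{n. ?P n}"] by blast
  have "compact I"
    using I(1,2) by (meson bounded_closed_interval bounded_subset compact_eq_bounded_closed)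
  moreover have "\<forall>n. (h \<circ> \<sigma>) n \<in> I" using \<sigma>(2) by auto
  ultimately obtain l \<tau> where l: "l \<in> I" "strict_mono \<tau>" "(h \<circ> \<sigma> \<circ> \<tau>) \<longlonglongrightarrow> l"
    unfolding compact_def by blast
  have "e \<le> dist l \<theta>"
  proof (rule tendsto_lowerbound)
    show "((\<lambda>n. dist ((h \<circ> \<sigma> \<circ> \<tau>) n) \<theta>) \<longlongrightarrow> dist l \<theta>) sequentially"
      by (intro tendsto_intros l)
    show "\<forall>\<^sub>F n in sequentially. e \<le> dist ((h \<circ> \<sigma> \<circ> \<tau>) n) \<theta>"
      using \<sigma>(2) by (simp add: not_less)
  qed simp
  then have ne: "l \<noteq> \<theta>" using e by auto
  have range: "0 \<le> l" "l \<le> 1" "\<epsilon> = 0 \<Longrightarrow> 0 < l \<and> l < 1"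
    using l(1) I(2,3) by auto
  obtain \<eta> \<kappa> where \<eta>: "0 < \<eta>" "0 < \<kappa>"
    and sep: "\<forall>\<^sub>F n in sequentially. \<forall>\<nu>\<in>{0<..<1}. \<bar>\<nu> - l\<bar> < \<eta> \<longrightarrow> ereal (robj n \<theta> + \<kappa>) \<le> obj n \<nu>"
    using separation[OF c inc range(1,2) ne range(3)] by blast
  have "\<forall>\<^sub>F n in sequentially. \<bar>g n - \<theta>\<bar> * (2 * LB) < \<kappa>"
  proof (rule order_tendstoD(2))
    show "(\<lambda>n. \<bar>g n - \<theta>\<bar> * (2 * LB)) \<longlonglongrightarrow> \<bar>\<theta> - \<theta>\<bar> * (2 * LB)"
      by (intro tendsto_intros g)
  qed (use \<eta> in simp)
  moreover have "\<forall>\<^sub>F n in sequentially. bd 0 \<theta> n" "\<forall>\<^sub>F n in sequentially. bd \<theta> 1 n"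
    using eventually_bd theta by auto
  ultimately have "\<forall>\<^sub>F n in sequentially. obj n (g n) < ereal (robj n \<theta> + \<kappa>)"
    using g(2)
  proof eventually_elim
    case (elim n)
    have "obj n (g n) = ereal (robj n (g n))"
      using elim by (intro obj_eq_robj[OF k_pos]) (auto simp: bd_def)
    \<comment> \<open>At \<open>g n\<close> both moments are those at \<open>\<theta>\<close>; only
      the weights differ, by an amount that vanishes with \<open>g n - \<theta>\<close>.\<close>
    moreover have "robj n (g n) = robj n \<theta> + (g n - \<theta>) * (ld 0 \<theta> n - ld \<theta> 1 n)"
      using elim(4) by (simp add: robj_def ld_def algebra_simps)
    moreover have "(g n - \<theta>) * (ld 0 \<theta> n - ld \<theta> 1 n) \<le> \<bar>g n - \<theta>\<bar> * (2 * LB)"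
      using bd_ld[OF elim(2)] bd_ld[OF elim(3)] by (intro mult_abs_bounds) auto
    ultimately show ?case using elim(1) by simp
  qed
  with sep have "\<forall>\<^sub>F n in sequentially. \<forall>\<nu>\<in>{0<..<1}. \<bar>\<nu> - l\<bar> < \<eta> \<longrightarrow> obj n (g n) < obj n \<nu>"
    by eventually_elim (auto intro: less_le_trans)
  then have "\<forall>\<^sub>F n in sequentially. \<forall>\<nu>\<in>{0<..<1}. \<bar>\<nu> - l\<bar> < \<eta> \<longrightarrow> obj ((\<sigma> \<circ> \<tau>) n) (g ((\<sigma> \<circ> \<tau>) n)) < obj ((\<sigma> \<circ> \<tau>) n) \<nu>"
    using eventually_subseq[OF strict_mono_o[OF \<sigma>(1) l(2)]] by blast
  moreover have "\<forall>\<^sub>F n in sequentially. \<bar>(h \<circ> \<sigma> \<circ> \<tau>) n - l\<bar> < \<eta>"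
    using l(3) \<eta>(1) by (auto simp: tendsto_iff dist_real_def)
  ultimately have "\<forall>\<^sub>F n in sequentially. False"
  proof eventually_elim
    case (elim n)
    then show ?case using \<sigma>(2)[of "\<tau> n"] by (auto simp: not_less[symmetric])
  qed
  then show False by simp
qed

end

section \<open>Spectral quantities of the block moments\<close>

text \<open>Identifies the set inside \<open>lambda_min\<close> as a finite nonempty range, so that
  its \<open>Min\<close> is attained.\<close>

lemma eigenvalues_diagonalization:
  fixes P :: "real ^ 'n ^ 'n"
  assumes P: "orthogonal_matrix P" and A: "A = P ** diag d ** transpose P"
  shows "{l. \<exists>v. v \<noteq> 0 \<and> A *v v = l *\<^sub>R v} = range d"
proof -
  have PT: "transpose P ** P = mat 1" "P ** transpose P = mat 1"
    using P by (auto simp: orthogonal_matrix_def)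
  have inv: "transpose P *v (P *v x) = x" "P *v (transpose P *v x) = x" for x
    by (simp_all only: matrix_vector_mul_assoc PT matrix_vector_mul_lid)
  have Av: "A *v v = P *v (diag d *v (transpose P *v v))" for v
    by (simp only: A matrix_vector_mul_assoc matrix_mul_assoc)
  have scale: "P *v (l *\<^sub>R x) = l *\<^sub>R (P *v x)" for l x
    by (simp add: matrix_vector_mult_scaleR)
  show ?thesis
  proof (intro equalityI subsetI)
    fix l assume "l \<in> {l. \<exists>v. v \<noteq> 0 \<and> A *v v = l *\<^sub>R v}"
    then obtain v where v: "v \<noteq> 0" "A *v v = l *\<^sub>R v" by blast
    let ?w = "transpose P *v v"
    have "?w \<noteq> 0" using v(1) inv(2)[of v] by force
    then obtain i where i: "?w $ i \<noteq> 0" by (auto simp: vec_eq_iff)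
    have "diag d *v ?w = transpose P *v (A *v v)"
      by (simp only: Av inv)
    also have "\<dots> = l *\<^sub>R ?w"
      by (simp add: v(2) matrix_vector_mult_scaleR)
    finally have "(diag d *v ?w) $ i = (l *\<^sub>R ?w) $ i" by simp
    then have "d i = l" using i by simp
    then show "l \<in> range d" by blast
  next
    fix l assume "l \<in> range d"
    then obtain i where i: "l = d i" by blast
    let ?v = "P *v axis i 1"
    have "transpose P *v ?v = axis i 1" by (rule inv)
    then have "?v \<noteq> 0" by (metis axis_eq_0_iff matrix_vector_mult_0_right zero_neq_one)
    moreover have "diag d *v axis i 1 = d i *\<^sub>R axis i 1"
      by (simp add: vec_eq_iff axis_def)
    then have "A *v ?v = d i *\<^sub>R ?v"
      by (simp only: Av inv scale)
    ultimately show "l \<in> {l. \<exists>v. v \<noteq> 0 \<and> A *v v = l *\<^sub>R v}"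
      using i by blast
  qed
qed

lemma
  fixes A :: "real ^ 'n ^ 'n"
  assumes "transpose A = A"
  shows lambda_min_eigenvalue: "\<exists>v. v \<noteq> 0 \<and> A *v v = lambda_min A *\<^sub>R v"
    and lambda_min_loewner: "lambda_min A *\<^sub>R mat 1 \<preceq> A"
proof -
  obtain P d where P: "orthogonal_matrix P" and A: "A = P ** diag d ** transpose P"
    using symmetric_diagonalization[OF assms] by blast
  have PT: "P ** transpose P = mat 1"
    using P by (auto simp: orthogonal_matrix_def)
  note ev = eigenvalues_diagonalization[OF P A]
  have lm: "lambda_min A = Min (range d)"
    by (simp add: lambda_min_def ev)
  then have "lambda_min A \<in> range d" by (simp add: Min_in)
  then show "\<exists>v. v \<noteq> 0 \<and> A *v v = lambda_min A *\<^sub>R v"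
    unfolding ev[symmetric] by blast
  have le: "lambda_min A \<le> d i" for i
    by (simp add: lm)
  have "diag (\<lambda>i. lambda_min A) = lambda_min A *\<^sub>R (mat 1 :: real ^ 'n ^ 'n)"
    using diag_scaleR[of "lambda_min A" "\<lambda>i. 1", symmetric] by (simp add: diag_one)
  then have eq: "P ** diag (\<lambda>i. lambda_min A) ** transpose P = lambda_min A *\<^sub>R mat 1"
    by (simp add: matrix_mult_scaleR scaleR_matrix_mult PT)
  have "x \<bullet> ((P ** diag (\<lambda>i. lambda_min A) ** transpose P) *v x)
      \<le> x \<bullet> ((P ** diag d ** transpose P) *v x)" for x
    unfolding inner_congruence_diag using le by (intro sum_mono mult_right_mono) auto
  then show "lambda_min A *\<^sub>R mat 1 \<preceq> A"
    by (simp add: loewner_def eq flip: A)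
qed

lemma norm_le_op_norm: "norm (A *v x) \<le> op_norm A * norm x"
  unfolding op_norm_def by (intro onorm matrix_vector_mul_bounded_linear)

lemma op_norm_loewner: "A \<preceq> op_norm A *\<^sub>R mat 1"
  unfolding loewner_mat_scaleR
proof
  fix x
  have "x \<bullet> (A *v x) \<le> norm x * norm (A *v x)"
    by (rule norm_cauchy_schwarz)
  also have "\<dots> \<le> norm x * (op_norm A * norm x)"
    by (intro mult_left_mono norm_le_op_norm) auto
  finally show "x \<bullet> (A *v x) \<le> op_norm A * (norm x)\<^sup>2"
    by (simp add: power2_eq_square mult_ac)
qed

text \<open>Serves to place the spectral floor below the ceiling, so that a finite ceiling makes
  both real.\<close>

lemma lambda_min_le_op_norm:
  assumes "transpose A = A"
  shows "lambda_min A \<le> op_norm A"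
proof -
  obtain v where v: "v \<noteq> 0" "A *v v = lambda_min A *\<^sub>R v"
    using lambda_min_eigenvalue[OF assms] by blast
  have "\<bar>lambda_min A\<bar> * norm v \<le> op_norm A * norm v"
    using norm_le_op_norm[of A v] v(2) by simp
  then show ?thesis using v(1) by simp
qed

lemma lambda_min_nonneg:
  assumes "transpose A = A" "0 \<preceq> A"
  shows "0 \<le> lambda_min A"
proof -
  obtain v where v: "v \<noteq> 0" "A *v v = lambda_min A *\<^sub>R v"
    using lambda_min_eigenvalue[OF assms(1)] by blast
  have "0 \<le> v \<bullet> (A *v v)" using assms(2) by (simp add: loewner_0)
  moreover have "0 < v \<bullet> v" using v(1) by simp
  ultimately show ?thesis by (simp add: v(2) zero_le_mult_iff)
qed

lemma frob_norm_eq_norm: "frob_norm A = norm A"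
  by (simp add: frob_norm_def norm_eq_sqrt_inner inner_vec_def power2_eq_square)

section \<open>The blocks of a signal\<close>

lemma floor_fraction_tendsto:
  assumes "0 \<le> x"
  shows "(\<lambda>n. real (nat \<lfloor>x * real n\<rfloor>) / n) \<longlonglongrightarrow> x"
proof (rule real_tendsto_sandwich)
  show "\<forall>\<^sub>F n in sequentially. x - 1 / real n \<le> real (nat \<lfloor>x * real n\<rfloor>) / n"
    using eventually_gt_at_top[of 0]
  proof eventually_elim
    case (elim n)
    have "x * n - 1 \<le> real (nat \<lfloor>x * real n\<rfloor>)"
      using assms by simp
    then have "(x * n - 1) / n \<le> real (nat \<lfloor>x * real n\<rfloor>) / n"
      by (intro divide_right_mono) auto
    then show ?case using elim by (simp add: diff_divide_distrib)
  qed
  show "\<forall>\<^sub>F n in sequentially. real (nat \<lfloor>x * real n\<rfloor>) / n \<le> x"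
    using eventually_gt_at_top[of 0]
    by eventually_elim (use assms in \<open>simp add: pos_divide_le_eq\<close>)
  have "(\<lambda>n. x - 1 / real n) \<longlonglongrightarrow> x - 0"
    by (intro tendsto_intros lim_1_over_n)
  then show "(\<lambda>n. x - 1 / real n) \<longlonglongrightarrow> x" by simp
qed simp

definition block_size :: "real \<Rightarrow> real \<Rightarrow> nat \<Rightarrow> real" where
  "block_size a b n = real (card (block n a b))"

definition block_sum :: "'q::finite signal \<Rightarrow> real \<Rightarrow> real \<Rightarrow> nat \<Rightarrow> real ^ 'q ^ 'q" where
  "block_sum y a b n = (\<Sum>t\<in>block n a b. outer (y n t))"

lemma block_split:
  assumes "0 \<le> a" "a \<le> b" "b \<le> c"
  shows "block n a c = block n a b \<union> block n b c" "block n a b \<inter> block n b c = {}"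
proof -
  have "a * real n \<le> b * real n" "b * real n \<le> c * real n"
    using assms by (auto intro: mult_right_mono)
  then have "nat \<lfloor>a * real n\<rfloor> \<le> nat \<lfloor>b * real n\<rfloor>" "nat \<lfloor>b * real n\<rfloor> \<le> nat \<lfloor>c * real n\<rfloor>"
    by (auto intro!: nat_mono floor_mono)
  then show "block n a c = block n a b \<union> block n b c" "block n a b \<inter> block n b c = {}"
    by (auto simp: block_def)
qed

lemma finite_block [simp]: "finite (block n a b)"
  by (simp add: block_def)

lemma outer_sym: "transpose (outer v) = outer v"
  by (simp add: outer_def transpose_def vec_eq_iff mult.commute)

lemma inner_outer: "x \<bullet> (outer v *v x) = (v \<bullet> x)\<^sup>2"
  by (simp add: outer_def inner_vec_def matrix_vector_mult_def power2_eq_square sum_product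
      sum_distrib_left mult_ac)

lemma sum_matrix_vector_mult: "sum f T *v x = (\<Sum>t\<in>T. f t *v x)" for x :: "real ^ 'm"
  by (induction T rule: infinite_finite_induct) (auto simp: matrix_vector_mult_add_rdistrib)

lemma transpose_sum: "transpose (sum f T) = (\<Sum>t\<in>T. transpose (f t))" for f :: "_ \<Rightarrow> real ^ 'm ^ 'n"
  by (simp add: transpose_def vec_eq_iff)

lemma block_family_signal: "0 \<le> \<epsilon> \<Longrightarrow> block_family block_size (block_sum y) \<epsilon>"
proof
  fix a b c :: real and n
  assume abc: "0 \<le> a" "a \<le> b" "b \<le> c"
  show "block_size a c n = block_size a b n + block_size b c n"
    unfolding block_size_def using block_split[OF abc, of n] by (simp add: card_Un_disjoint)
  show "block_sum y a c n = block_sum y a b n + block_sum y b c n"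
    unfolding block_sum_def using block_split[OF abc, of n] by (simp add: sum.union_disjoint)
next
  fix a b :: real and n
  show "0 \<le> block_size a b n" by (simp add: block_size_def)
  show "transpose (block_sum y a b n) = block_sum y a b n"
    by (simp add: block_sum_def transpose_sum outer_sym)
  show "0 \<preceq> block_sum y a b n"
    by (simp add: loewner_0 block_sum_def sum_matrix_vector_mult inner_sum_right inner_outer sum_nonneg)
  show "block_sum y a b n = 0" if "block_size a b n = 0"
    using that by (simp add: block_size_def block_sum_def)
next
  fix a b :: real
  assume ab: "0 \<le> a" "a \<le> b" "b \<le> 1"
  have "block_size a b n / n = real (nat \<lfloor>b * real n\<rfloor>) / n - real (nat \<lfloor>a * real n\<rfloor>) / n" for n
  proof -
    have "nat \<lfloor>a * real n\<rfloor> \<le> nat \<lfloor>b * real n\<rfloor>"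
      using ab by (intro nat_mono floor_mono mult_right_mono) auto
    then show ?thesis
      by (simp add: block_size_def block_def of_nat_diff diff_divide_distrib)
  qed
  then show "(\<lambda>n. block_size a b n / n) \<longlonglongrightarrow> b - a"
    using ab by (simp only:) (intro tendsto_diff floor_fraction_tendsto; simp)
qed

section \<open>Relaxing the extremal quantities\<close>

text \<open>One small \<open>t\<close> relaxes all three numbers at once, by continuity of the left
  side at \<open>t = 0\<close>. A real \<open>D\<close> is inserted first, since \<open>X\<close>
  may be infinite.\<close>

lemma slack_exists:
  fixes r A B w :: real
  assumes "0 < r" "0 < B" "0 \<le> A" "0 \<le> w" "ereal (r * (A / B) * w) < X"
  obtains k K W D where "0 < k" "k < B" "A < K" "w < W" "0 \<le> D" "ereal D < X" "r * (W / k) < D / K"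
proof -
  obtain D where D: "ereal (r * (A / B) * w) < ereal D" "ereal D < X"
    using ereal_dense2[OF assms(5)] by blast
  have "((\<lambda>t. r * ((A + t) / (B - t)) * (w + t)) \<longlongrightarrow> r * ((A + 0) / (B - 0)) * (w + 0)) (at_right 0)"
    using assms by (intro tendsto_intros) auto
  then have "\<forall>\<^sub>F t in at_right 0. r * ((A + t) / (B - t)) * (w + t) < D"
    using D(1) by (intro order_tendstoD(2)[of _ "r * (A / B) * w"]) auto
  moreover have "\<forall>\<^sub>F t in at_right 0. t \<in> {0<..<B}"
    using assms by (intro eventually_at_right_real) auto
  ultimately have "\<forall>\<^sub>F t in at_right 0. r * ((A + t) / (B - t)) * (w + t) < D \<and> t \<in> {0<..<B}"
    by (rule eventually_conj)
  then obtain t where t: "r * ((A + t) / (B - t)) * (w + t) < D" "0 < t" "t < B"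
    using eventually_happens'[OF trivial_limit_at_right_real] by force
  show ?thesis
  proof (rule that[of "B - t" "A + t" "w + t" D])
    have "0 \<le> r * (A / B) * w" using assms by simp
    also have "\<dots> < D" using D(1) by simp
    finally show "0 \<le> D" by simp
    show "r * ((w + t) / (B - t)) < D / (A + t)"
      using t assms by (simp add: field_simps)
  qed (use t D in auto)
qed

text \<open>Used with \<open>r = 1\<close> for the local and
  \<open>r = 1 / (2 * sqrt (\<theta> * (1 - \<theta>)))\<close> for the global statement. The
  extremal quantities are first shown to be real, except the contrast between the regimes, which may
  be infinite.\<close>

lemma contrast_exists:
  fixes y :: "'q::finite signal"
  assumes theta: "0 < \<theta>" "\<theta> < 1" and eps: "0 \<le> \<epsilon>"
    and floor: "\<epsilon> = 0 \<longrightarrow> 0 < spectral_floor y \<theta>" and ceil: "spectral_ceiling y \<theta> < \<infinity>"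
    and r: "0 < r"
    and gap: "ereal r * ((spectral_ceiling y \<theta> + ereal \<epsilon>) / (spectral_floor y \<theta> + ereal \<epsilon>)) * delta_within y \<theta>
      < delta_between y \<theta>"
  obtains k K W D where "contrast block_size (block_sum y) \<epsilon> \<theta> k K W D" "r\<^sup>2 * (W\<^sup>2 / k\<^sup>2) < D\<^sup>2 / K\<^sup>2"
proof -
  interpret block_family block_size "block_sum y" \<epsilon>
    using eps by (rule block_family_signal)
  have Y: "Y a b n = second_moment y n a b + \<epsilon> *\<^sub>R mat 1" for a b n
    by (simp add: Y_def second_moment_def block_size_def block_sum_def)
  have dist: "moment_dist y n (a, b) (c, d) = ereal (norm (Y a b n - Y c d n))" for n a b c d
    by (simp add: moment_dist_def frob_norm_eq_norm Y)
  have sm: "second_moment y n a b = (1 / block_size a b n) *\<^sub>R block_sum y a b n" for n a b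
    by (simp add: second_moment_def block_size_def block_sum_def)
  have sym: "transpose (second_moment y n a b) = second_moment y n a b" for n a b
    by (simp add: sm transpose_scaleR S_sym)
  have psd: "0 \<preceq> second_moment y n a b" for n a b
    unfolding sm using loewner_scaleR[OF S_psd, of "1 / block_size a b n" a b n] N_nonneg by simp
  have ceil_ge: "limsup (\<lambda>n. ereal (op_norm (second_moment y n a b))) \<le> spectral_ceiling y \<theta>"
    if "(a, b) \<in> br_blocks \<theta>" for a b
    unfolding spectral_ceiling_def using that by (rule SUP_upper2) simp
  have floor_le: "spectral_floor y \<theta> \<le> liminf (\<lambda>n. ereal (lambda_min (second_moment y n a b)))"
    if "(a, b) \<in> cut_blocks \<theta>" for a b
    unfolding spectral_floor_def using that by (rule INF_lower2) simp
  have within_ge: "limsup (\<lambda>n. moment_dist y n p q) \<le> delta_within y \<theta>"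
    if "(p, q) \<in> pre_blocks \<theta> \<times> pre_blocks \<theta> \<union> post_blocks \<theta> \<times> post_blocks \<theta>" for p q
    unfolding delta_within_def using that by (rule SUP_upper2) simp
  have between_le: "delta_between y \<theta> \<le> liminf (\<lambda>n. moment_dist y n p q)"
    if "(p, q) \<in> pre_blocks \<theta> \<times> post_blocks \<theta>" for p q
    unfolding delta_between_def using that by (rule INF_lower2) simp
  have mem: "(0, \<theta>) \<in> br_blocks \<theta>" "(0, \<theta>) \<in> cut_blocks \<theta>" "(0, \<theta>) \<in> pre_blocks \<theta>"
    using theta by (auto simp: br_blocks_def cut_blocks_def pre_blocks_def)
  \<comment> \<open>The block \<open>(0, \<theta>)\<close> belongs to both families and links floor
    and ceiling.\<close>
  have "spectral_floor y \<theta> \<le> liminf (\<lambda>n. ereal (op_norm (second_moment y n 0 \<theta>)))"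
    using floor_le[OF mem(2)] by (rule order_trans) (intro Liminf_mono always_eventually allI, simp add: lambda_min_le_op_norm sym)
  also have "\<dots> \<le> limsup (\<lambda>n. ereal (op_norm (second_moment y n 0 \<theta>)))"
    by (simp add: Liminf_le_Limsup)
  also have "\<dots> \<le> spectral_ceiling y \<theta>"
    by (rule ceil_ge[OF mem(1)])
  finally have floor_le_ceil: "spectral_floor y \<theta> \<le> spectral_ceiling y \<theta>" .
  have floor_nonneg: "0 \<le> spectral_floor y \<theta>"
    unfolding spectral_floor_def
    by (intro INF_greatest, clarify, intro Liminf_bounded always_eventually allI) (simp add: lambda_min_nonneg sym psd)
  obtain M where M: "spectral_ceiling y \<theta> = ereal M"
    using ceil floor_le_ceil floor_nonneg by (cases "spectral_ceiling y \<theta>") auto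
  obtain m where m: "spectral_floor y \<theta> = ereal m"
    using M floor_le_ceil floor_nonneg by (cases "spectral_floor y \<theta>") auto
  have mM: "0 \<le> m" "m \<le> M" "0 < m + \<epsilon>"
    using floor_nonneg floor_le_ceil floor eps unfolding m M by auto
  have within_nonneg: "0 \<le> delta_within y \<theta>"
  proof -
    have "0 \<le> limsup (\<lambda>n. moment_dist y n (0, \<theta>) (0, \<theta>))"
      by (simp add: dist Limsup_const flip: zero_ereal_def)
    also have "\<dots> \<le> delta_within y \<theta>" using mem(3) by (intro within_ge) auto
    finally show ?thesis .
  qed
  have ratio: "ereal r * ((spectral_ceiling y \<theta> + ereal \<epsilon>) / (spectral_floor y \<theta> + ereal \<epsilon>)) = ereal (r * ((M + \<epsilon>) / (m + \<epsilon>)))"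
    using mM by (simp add: m M)
  have ratio_pos: "0 < r * ((M + \<epsilon>) / (m + \<epsilon>))"
    using mM r by simp
  \<comment> \<open>The ratio in front is positive, so an infinite fluctuation would make the
    smaller side of \<open>gap\<close> infinite.\<close>
  have "delta_within y \<theta> \<noteq> \<infinity>"
  proof
    assume inf: "delta_within y \<theta> = \<infinity>"
    have "ereal x * \<infinity> = \<infinity>" if "0 < x" for x
      using that by simp
    from this[OF ratio_pos] show False
      using gap unfolding ratio inf by simp
  qed
  then obtain w where w: "delta_within y \<theta> = ereal w"
    using within_nonneg by (cases "delta_within y \<theta>") auto
  have w0: "0 \<le> w" using within_nonneg w by simp
  have A0: "0 \<le> M + \<epsilon>" using mM eps by simp
  have gap': "ereal (r * ((M + \<epsilon>) / (m + \<epsilon>)) * w) < delta_between y \<theta>"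
    using gap unfolding ratio w by simp
  obtain k K W D where *: "0 < k" "k < m + \<epsilon>" "M + \<epsilon> < K" "w < W" "0 \<le> D" "ereal D < delta_between y \<theta>"
    "r * (W / k) < D / K"
    by (rule slack_exists[OF r mM(3) A0 w0 gap'])
  have slack: "ereal (k - \<epsilon>) < spectral_floor y \<theta>" "spectral_ceiling y \<theta> < ereal (K - \<epsilon>)"
    "delta_within y \<theta> < ereal W"
    using *(2,3,4) m M w by auto
  have lower: "\<forall>\<^sub>F n in sequentially. k *\<^sub>R mat 1 \<preceq> Y a b n" if "(a, b) \<in> cut_blocks \<theta>" for a b
    using less_LiminfD[OF less_le_trans[OF slack(1) floor_le[OF that]]]
  proof eventually_elim
    case (elim n)
    have "(k - \<epsilon>) *\<^sub>R mat 1 \<preceq> second_moment y n a b"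
      using elim by (intro loewner_trans[OF loewner_mat_mono lambda_min_loewner[OF sym]]) simp
    from loewner_add[OF this loewner_refl[of "\<epsilon> *\<^sub>R mat 1"]] show ?case
      by (simp add: Y scaleR_left_diff_distrib)
  qed
  have upper: "\<forall>\<^sub>F n in sequentially. Y a b n \<preceq> K *\<^sub>R mat 1" if "(a, b) \<in> br_blocks \<theta>" for a b
    using Limsup_lessD[OF le_less_trans[OF ceil_ge[OF that] slack(2)]]
  proof eventually_elim
    case (elim n)
    have "second_moment y n a b \<preceq> (K - \<epsilon>) *\<^sub>R mat 1"
      using elim by (intro loewner_trans[OF op_norm_loewner loewner_mat_mono]) simp
    from loewner_add[OF this loewner_refl[of "\<epsilon> *\<^sub>R mat 1"]] show ?case
      by (simp add: Y scaleR_left_diff_distrib)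
  qed
  have within: "\<forall>\<^sub>F n in sequentially. norm (Y a b n - Y c d n) \<le> W"
    if "(a, b) \<in> pre_blocks \<theta> \<and> (c, d) \<in> pre_blocks \<theta> \<or> (a, b) \<in> post_blocks \<theta> \<and> (c, d) \<in> post_blocks \<theta>" for a b c d
  proof -
    have "((a, b), (c, d)) \<in> pre_blocks \<theta> \<times> pre_blocks \<theta> \<union> post_blocks \<theta> \<times> post_blocks \<theta>"
      using that by blast
    from Limsup_lessD[OF le_less_trans[OF within_ge[OF this] slack(3)]] show ?thesis
      by eventually_elim (simp add: dist)
  qed
  have between: "\<forall>\<^sub>F n in sequentially. D \<le> norm (Y a b n - Y c d n)"
    if "(a, b) \<in> pre_blocks \<theta>" "(c, d) \<in> post_blocks \<theta>" for a b c d
  proof -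
    have "((a, b), (c, d)) \<in> pre_blocks \<theta> \<times> post_blocks \<theta>"
      using that by blast
    from less_LiminfD[OF less_le_trans[OF *(6) between_le[OF this]]] show ?thesis
      by eventually_elim (simp add: dist)
  qed
  have "0 \<le> W" using w0 *(4) by simp
  have "contrast block_size (block_sum y) \<epsilon> \<theta> k K W D"
    by (intro contrast.intro contrast_axioms.intro block_family_axioms theta *(1) \<open>0 \<le> W\<close> *(5) lower upper within between)
  moreover have "r\<^sup>2 * (W\<^sup>2 / k\<^sup>2) < D\<^sup>2 / K\<^sup>2"
  proof -
    \<comment> \<open>The Jensen gaps are quadratic in the distances, so the linear condition is
      squared.\<close>
    have "(r * (W / k))\<^sup>2 < (D / K)\<^sup>2"
      using * r w0 by (intro power_strict_mono) auto
    then show ?thesis by (simp add: power_mult_distrib power_divide)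
  qed
  ultimately show ?thesis by (rule that)
qed

lemma qml_eq_obj:
  assumes "0 \<le> \<epsilon>"
  shows "qml y \<epsilon> n \<nu> = block_family.obj block_size (block_sum y) \<epsilon> n \<nu>"
proof -
  interpret block_family block_size "block_sum y" \<epsilon>
    using assms by (rule block_family_signal)
  show ?thesis
    by (simp add: qml_def obj_def Y_def second_moment_def block_size_def block_sum_def)
qed

lemma floor_grid_point:
  assumes "0 \<le> \<theta>" "0 < n"
  shows "\<lfloor>real (nat \<lfloor>\<theta> * real n\<rfloor>) / real n * real n\<rfloor> = \<lfloor>\<theta> * real n\<rfloor>"
  using assms by simp

text \<open>\<open>\<theta>\<close> rounded down to a multiple of \<open>1 / n\<close> is eventually
  a grid point, so the grid is nonempty and this point competes with the minimizer. The set
  \<open>I\<close> covers the full and the trimmed grid together.\<close>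

lemma minimizers_eventually:
  assumes \<theta>: "0 < \<theta>" "\<theta> < 1" and h: "minimizer_seq y \<epsilon> D h"
    and D: "\<And>n. D n = grid n \<inter> I" and I: "\<forall>\<^sub>F n in sequentially. real (nat \<lfloor>\<theta> * real n\<rfloor>) / real n \<in> I"
  shows "\<forall>\<^sub>F n in sequentially. h n \<in> I \<inter> {0<..<1} \<and> qml y \<epsilon> n (h n) \<le> qml y \<epsilon> n (real (nat \<lfloor>\<theta> * real n\<rfloor>) / real n)"
proof -
  let ?g = "\<lambda>n. real (nat \<lfloor>\<theta> * real n\<rfloor>) / real n"
  have g: "?g \<longlonglongrightarrow> \<theta>" using \<theta> by (intro floor_fraction_tendsto) simp
  have "\<forall>\<^sub>F n in sequentially. 0 < ?g n" "\<forall>\<^sub>F n in sequentially. ?g n < 1"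
    using order_tendstoD(1)[OF g \<theta>(1)] order_tendstoD(2)[OF g \<theta>(2)] .
  then show ?thesis
    using I eventually_gt_at_top[of 0]
  proof eventually_elim
    case (elim n)
    have "real k / real n \<in> grid n" if "0 < real k / real n" "real k / real n < 1" for k
      unfolding grid_def using that elim(4) by (intro CollectI exI[of _ k]) (auto simp: zero_less_divide_iff)
    then have "?g n \<in> grid n" using elim(1,2) by blast
    then have gD: "?g n \<in> D n" using elim(3) D by simp
    then have am: "is_arg_min (qml y \<epsilon> n) (\<lambda>\<nu>. \<nu> \<in> D n) (h n)"
      using h unfolding minimizer_seq_def by blast
    have "h n \<in> D n" "\<not> qml y \<epsilon> n (?g n) < qml y \<epsilon> n (h n)"
      using am gD by (auto simp: is_arg_min_def)
    moreover have "grid n \<subseteq> {0<..<1}"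
      using elim(4) by (auto simp: grid_def)
    ultimately show ?case using D by auto
  qed
qed

theorem theorem23:
  fixes y :: "'q::finite signal" and \<theta> \<epsilon> :: real
  assumes "0 < \<theta>" and "\<theta> < 1"
    and "0 \<le> \<epsilon>"
    and "\<epsilon> = 0 \<longrightarrow> 0 < spectral_floor y \<theta>"
    and "spectral_ceiling y \<theta> < \<infinity>"
  shows
    "(delta_between y \<theta> >
        (spectral_ceiling y \<theta> + ereal \<epsilon>) / (spectral_floor y \<theta> + ereal \<epsilon>) * delta_within y \<theta>
      \<longrightarrow> (\<exists>\<delta> c. 0 < \<delta> \<and> 0 < c \<and>
            (\<forall>\<nu>\<in>{\<theta> - \<delta><..<\<theta> + \<delta>} \<inter> {0<..<1}.
               liminf (\<lambda>n. qml y \<epsilon> n \<nu> - qml y \<epsilon> n \<theta>) \<ge> ereal (c * \<bar>\<nu> - \<theta>\<bar>))))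
     \<and>
     (delta_between y \<theta> >
        ereal (1 / (2 * sqrt (\<theta> * (1 - \<theta>))))
        * ((spectral_ceiling y \<theta> + ereal \<epsilon>) / (spectral_floor y \<theta> + ereal \<epsilon>)) * delta_within y \<theta>
      \<longrightarrow> (\<exists>c>0. \<forall>\<nu>\<in>{0<..<1}.
             liminf (\<lambda>n. qml y \<epsilon> n \<nu> - qml y \<epsilon> n \<theta>) \<ge> ereal (c * \<bar>\<nu> - \<theta>\<bar>))
        \<and> (\<epsilon> > 0 \<longrightarrow> (\<forall>h. minimizer_seq y \<epsilon> grid h \<longrightarrow> h \<longlonglongrightarrow> \<theta>))
        \<and> (\<epsilon> = 0 \<longrightarrow> (\<forall>\<delta>\<in>{0<..<min \<theta> (1 - \<theta>)}. \<forall>h.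
             minimizer_seq y \<epsilon> (trimmed_grid \<delta>) h \<longrightarrow> h \<longlonglongrightarrow> \<theta>)))"
proof (rule conjI; rule impI)
  assume gap: "delta_between y \<theta> >
    (spectral_ceiling y \<theta> + ereal \<epsilon>) / (spectral_floor y \<theta> + ereal \<epsilon>) * delta_within y \<theta>"
  have gap': "ereal 1 * ((spectral_ceiling y \<theta> + ereal \<epsilon>) / (spectral_floor y \<theta> + ereal \<epsilon>)) * delta_within y \<theta>
    < delta_between y \<theta>"
    using gap by (simp only: one_ereal_def[symmetric] mult_1_left)
  obtain k K W D where con: "contrast block_size (block_sum y) \<epsilon> \<theta> k K W D" "1\<^sup>2 * (W\<^sup>2 / k\<^sup>2) < D\<^sup>2 / K\<^sup>2"
    by (rule contrast_exists[OF assms zero_less_one gap'])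
  interpret contrast block_size "block_sum y" \<epsilon> \<theta> k K W D
    by (rule con)
  obtain \<delta> c where "0 < \<delta>" "0 < c" and inc: "\<And>\<nu> r. \<nu>\<in>{\<theta> - \<delta><..<\<theta> + \<delta>} \<inter> {0<..<1} \<Longrightarrow> r < c * \<bar>\<nu> - \<theta>\<bar> \<Longrightarrow>
    \<forall>\<^sub>F n in sequentially. r < robj n \<nu> - robj n \<theta>"
    using increment_local con(2) by auto
  moreover have "ereal (c * \<bar>\<nu> - \<theta>\<bar>) \<le> liminf (\<lambda>n. qml y \<epsilon> n \<nu> - qml y \<epsilon> n \<theta>)"
    if "\<nu>\<in>{\<theta> - \<delta><..<\<theta> + \<delta>} \<inter> {0<..<1}" for \<nu>
    unfolding qml_eq_obj[OF assms(3)] using that inc by (intro liminf_obj) auto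
  ultimately show "\<exists>\<delta> c. 0 < \<delta> \<and> 0 < c \<and> (\<forall>\<nu>\<in>{\<theta> - \<delta><..<\<theta> + \<delta>} \<inter> {0<..<1}.
    liminf (\<lambda>n. qml y \<epsilon> n \<nu> - qml y \<epsilon> n \<theta>) \<ge> ereal (c * \<bar>\<nu> - \<theta>\<bar>))"
    by blast
next
  let ?r = "1 / (2 * sqrt (\<theta> * (1 - \<theta>)))"
  assume gap: "delta_between y \<theta> > ereal ?r
    * ((spectral_ceiling y \<theta> + ereal \<epsilon>) / (spectral_floor y \<theta> + ereal \<epsilon>)) * delta_within y \<theta>"
  have t: "0 < \<theta> * (1 - \<theta>)" using assms(1,2) by simp
  have "0 < ?r" using t by simp
  then obtain k K W D where con: "contrast block_size (block_sum y) \<epsilon> \<theta> k K W D" "?r\<^sup>2 * (W\<^sup>2 / k\<^sup>2) < D\<^sup>2 / K\<^sup>2"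
    using contrast_exists[OF assms _ gap] by blast
  interpret contrast block_size "block_sum y" \<epsilon> \<theta> k K W D
    by (rule con)
  \<comment> \<open>The squared constant is the reciprocal of the factor required by
    \<open>increment_global\<close>.\<close>
  have r2: "?r\<^sup>2 = 1 / (4 * (\<theta> * (1 - \<theta>)))"
    using t by (simp add: power_divide power_mult_distrib)
  have "a < s * b" if "0 < s" "1 / s * a < b" for a b s :: real
    using that by (simp add: pos_divide_less_eq mult.commute)
  from this[OF _ con(2)[unfolded r2]]
  have "W\<^sup>2 / k\<^sup>2 < 4 * (\<theta> * (1 - \<theta>)) * (D\<^sup>2 / K\<^sup>2)"
    using t by simp
  then obtain c where c: "0 < c" and inc: "\<And>\<nu> r. 0 < \<nu> \<Longrightarrow> \<nu> < 1 \<Longrightarrow> r < c * \<bar>\<nu> - \<theta>\<bar> \<Longrightarrow>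
    \<forall>\<^sub>F n in sequentially. r < robj n \<nu> - robj n \<theta>"
    using increment_global by auto
  let ?g = "\<lambda>n. real (nat \<lfloor>\<theta> * real n\<rfloor>) / real n"
  have g: "?g \<longlonglongrightarrow> \<theta>" using assms(1) by (intro floor_fraction_tendsto) simp
  have gY: "\<forall>\<^sub>F n in sequentially. Y 0 (?g n) n = Y 0 \<theta> n \<and> Y (?g n) 1 n = Y \<theta> 1 n"
    using eventually_gt_at_top[of 0]
  proof eventually_elim
    case (elim n)
    have "block n 0 (?g n) = block n 0 \<theta>" "block n (?g n) 1 = block n \<theta> 1"
      unfolding block_def floor_grid_point[OF less_imp_le[OF assms(1)] elim] by simp_all
    then show ?case by (simp add: Y_def block_size_def block_sum_def)
  qed
  \<comment> \<open>Applied with \<open>I = {0..1}\<close> for untrimmed and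
    \<open>I = {\<delta>..1 - \<delta>}\<close> for trimmed estimators.\<close>
  have conv: "h \<longlonglongrightarrow> \<theta>" if "minimizer_seq y \<epsilon> D' h" "\<And>n. D' n = grid n \<inter> I" "closed I" "I \<subseteq> {0..1}"
    "\<epsilon> = 0 \<Longrightarrow> I \<subseteq> {0<..<1}" "\<forall>\<^sub>F n in sequentially. ?g n \<in> I" for h D' I
    using minimizers_eventually[OF assms(1,2) that(1,2,6)] unfolding qml_eq_obj[OF assms(3)]
    by (intro minimizers_converge[OF c inc that(3,4,5) _ g gY])
  show "(\<exists>c>0. \<forall>\<nu>\<in>{0<..<1}. liminf (\<lambda>n. qml y \<epsilon> n \<nu> - qml y \<epsilon> n \<theta>) \<ge> ereal (c * \<bar>\<nu> - \<theta>\<bar>))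
    \<and> (\<epsilon> > 0 \<longrightarrow> (\<forall>h. minimizer_seq y \<epsilon> grid h \<longrightarrow> h \<longlonglongrightarrow> \<theta>))
    \<and> (\<epsilon> = 0 \<longrightarrow> (\<forall>\<delta>\<in>{0<..<min \<theta> (1 - \<theta>)}. \<forall>h. minimizer_seq y \<epsilon> (trimmed_grid \<delta>) h \<longrightarrow> h \<longlonglongrightarrow> \<theta>))"
  proof (intro conjI impI allI ballI)
    have "ereal (c * \<bar>\<nu> - \<theta>\<bar>) \<le> liminf (\<lambda>n. qml y \<epsilon> n \<nu> - qml y \<epsilon> n \<theta>)" if "\<nu>\<in>{0<..<1}" for \<nu>
      unfolding qml_eq_obj[OF assms(3)] using that inc by (intro liminf_obj) auto
    with c show "\<exists>c>0. \<forall>\<nu>\<in>{0<..<1}. liminf (\<lambda>n. qml y \<epsilon> n \<nu> - qml y \<epsilon> n \<theta>) \<ge> ereal (c * \<bar>\<nu> - \<theta>\<bar>)"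
      by blast
  next
    fix h assume "0 < \<epsilon>" and h: "minimizer_seq y \<epsilon> grid h"
    have "\<forall>\<^sub>F n in sequentially. 0 < ?g n" "\<forall>\<^sub>F n in sequentially. ?g n < 1"
      using order_tendstoD(1)[OF g assms(1)] order_tendstoD(2)[OF g assms(2)] .
    then have "\<forall>\<^sub>F n in sequentially. ?g n \<in> {0..1}"
      by eventually_elim auto
    moreover have "grid n = grid n \<inter> {0..1}" for n
      by (auto simp: grid_def)
    ultimately show "h \<longlonglongrightarrow> \<theta>"
      using \<open>0 < \<epsilon>\<close> by (intro conv[OF h, where I = "{0..1}"]) auto
  next
    \<comment> \<open>Since \<open>\<delta> < \<theta> < 1 - \<delta>\<close>, the competing points
      \<open>?g n\<close> survive the trimming for large \<open>n\<close>.\<close>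
    fix \<delta> h assume \<delta>: "\<delta> \<in> {0<..<min \<theta> (1 - \<theta>)}" and h: "minimizer_seq y \<epsilon> (trimmed_grid \<delta>) h"
    have "\<forall>\<^sub>F n in sequentially. \<delta> < ?g n" "\<forall>\<^sub>F n in sequentially. ?g n < 1 - \<delta>"
      using order_tendstoD(1)[OF g, of \<delta>] order_tendstoD(2)[OF g, of "1 - \<delta>"] \<delta> by simp_all
    then have "\<forall>\<^sub>F n in sequentially. ?g n \<in> {\<delta>..1 - \<delta>}"
      by eventually_elim auto
    then show "h \<longlonglongrightarrow> \<theta>"
      using \<delta> by (intro conv[OF h trimmed_grid_def[of \<delta>]]) auto
  qed
qed

end
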